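(* Let $\alpha>-1/2$ and $b>0$. Let $f$ be a function in $L^1_\alpha(\mathbb{R}^+)$ such that $\mathrm{supp}\,\mathcal{F}_\alpha(f)\subset[0,b]$. Then $f$ is (the restriction to $\mathbb{R}^+$, up to equality almost everywhere, of) an even entire function such that, for every integer $k\geq 0$, $$\|D^kf\|_{L^2_{\alpha+k}}\ \leq\ \sqrt{\frac{\Gamma(\alpha+1)}{\Gamma(\alpha+k+1)}}\,\big(\sqrt{\pi^3}\,b\big)^k\,\|f\|_{L^2_\alpha}.$$
   Context: Here $\mathbb{R}^+=[0,\infty)$. For $\alpha>-1/2$, let $d\mu_\alpha(x)=\frac{2\pi^{\alpha+1}}{\Gamma(\alpha+1)}x^{2\alpha+1}\,dx$ on $\mathbb{R}^+$. For $1\le p<\infty$, $L^p_\alpha(\mathbb{R}^+)$ is the space of (complex-valued) measurable functions on $\mathbb{R}^+$ with $\|f\|_{L^p_\alpha}=\left(\int_0^\infty|f|^p\,d\mu_\alpha\right)^{1/p}<\infty$. The Fourier-Bessel (Hankel) transform of $f\in L^1_\alpha(\mathbb{R}^+)$ is $\mathcal{F}_\alpha(f)(y)=\int_0^\infty f(x)\,j_\alpha(2\pi xy)\,d\mu_\alpha(x)$, where $j_\alpha(x)=\Gamma(\alpha+1)\sum_{n=0}^\infty\frac{(-1)^n}{n!\,\Gamma(n+\alpha+1)}\left(\frac{x}{2}\right)^{2n}$. For an even entire function $f(z)=\sum_{n=0}^\infty a_nz^{2n}$, define $Df=\frac{1}{2z}\frac{df}{dz}$, i.e. $Df(z)=\sum_{n=0}^\infty(n+1)a_{n+1}z^{2n}$,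 which is again even and entire; $D^k$ denotes the $k$-fold iterate of $D$ (with $D^0f=f$). *)

theory Defs
  imports "HOL-Complex_Analysis.Complex_Analysis"
begin

(* Measurability is with respect to the Lebesgue sigma-algebra. *)
definition mu_meas :: "real \<Rightarrow> real measure" where
  "mu_meas \<alpha> = density (lebesgue_on {0..})
     (\<lambda>x. ennreal (2 * pi powr (\<alpha> + 1) / Gamma (\<alpha> + 1) * x powr (2 * \<alpha> + 1)))"

(* The norm takes values in [0, \<infinity>], so that it is meaningful for every measurable function;
   the conditional is the power t powr (1 / p) extended by \<infinity> at t = \<infinity>. *)
definition Lp_norm :: "real \<Rightarrow> real \<Rightarrow> (real \<Rightarrow> complex) \<Rightarrow> ennreal" where
  "Lp_norm p \<alpha> f =
     (let I = (\<integral>\<^sup>+ x. ennreal (norm (f x) powr p) \<partial>mu_meas \<alpha>)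
      in if I = \<infinity> then \<infinity> else ennreal (enn2real I powr (1 / p)))"

(* Functions on [0, \<infinity>) are functions on the reals whose values at negative arguments
   play no role. *)
definition Lp_space :: "real \<Rightarrow> real \<Rightarrow> (real \<Rightarrow> complex) set" where
  "Lp_space p \<alpha> = {f. f \<in> borel_measurable (mu_meas \<alpha>) \<and> Lp_norm p \<alpha> f < \<infinity>}"

definition bessel_j :: "real \<Rightarrow> real \<Rightarrow> real" where
  "bessel_j \<alpha> x = Gamma (\<alpha> + 1) *
     (\<Sum>n. (- 1) ^ n / (fact n * Gamma (real n + \<alpha> + 1)) * (x / 2) ^ (2 * n))"

definition fourier_bessel :: "real \<Rightarrow> (real \<Rightarrow> complex) \<Rightarrow> real \<Rightarrow> complex" where
  "fourier_bessel \<alpha> f y =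
     (\<integral>x. f x * complex_of_real (bessel_j \<alpha> (2 * pi * x * y)) \<partial>mu_meas \<alpha>)"

(* The topological support of a function on [0, \<infinity>). *)
definition supp :: "(real \<Rightarrow> complex) \<Rightarrow> real set" where
  "supp F = closure (support_on {0..} F)"

definition even_entire :: "(complex \<Rightarrow> complex) \<Rightarrow> bool" where
  "even_entire g \<longleftrightarrow> g holomorphic_on UNIV \<and> (\<forall>z. g (- z) = g z)"

(* D f = f' / (2 z).  For f(z) = (\<Sum>n. a n * z ^ (2 * n)) the singularity at 0 is removable, with
   value a 1 = f''(0) / 2 there. *)
definition D_op :: "(complex \<Rightarrow> complex) \<Rightarrow> complex \<Rightarrow> complex" where
  "D_op f z = (if z = 0 then (deriv ^^ 2) f 0 / 2 else deriv f z / (2 * z))"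

end

theory Submission
  imports Defs
begin

text \<open>
  The measure mu_meas is normalised so that, when 2 \<alpha> + 2 is an integer d, it is the radial part
  of Lebesgue measure on d-space and the Fourier-Bessel transform H_\<alpha> is the Fourier transform of
  radial functions.  For every real \<alpha> > -1/2 it remains true that H_\<alpha> is its own inverse and a
  contraction (in fact an isometry) in L2.

  Let F = H_\<alpha> f.  Since F is bounded and vanishes beyond b, inversion
  f(x) = \<integral> F(y) j_\<alpha>(2 \<pi> x y) d\<mu>_\<alpha>(y) can be integrated term by term in the power series of j_\<alpha>;
  this gives an even entire function of x.  As a function of z, the kernel j_\<alpha>(2 \<pi> z y) is sent
  by D to -(\<pi> y)^2 / (\<alpha> + 1) times j_(\<alpha>+1)(2 \<pi> z y), and y^2 d\<mu>_\<alpha> = (\<alpha> + 1) / \<pi> d\<mu>_(\<alpha>+1).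
  So D only raises the order of the transform:  D^k f = (-\<pi>)^k H_(\<alpha>+k) F.  The L2 contraction for
  the order \<alpha> + k, the bound y \<le> b on the carrier of F, and the L2 contraction for the order \<alpha> give
  the estimate with exactly the stated constant.

  The theory of H_\<alpha> is built from Gaussians exp(-\<pi> s x^2).  Three facts are computed by hand:
  |j_\<alpha>| \<le> 1 (an energy argument for the Bessel equation), the transform of a Gaussian (term by term),
  and the symmetry \<integral> f H_\<alpha> g = \<integral> (H_\<alpha> f) g (Fubini).  By the explicit formula H_\<alpha> is
  isometric on the span of the Gaussians.  For natural s the Gaussians are the powers of v = exp(-\<pi> x^2), so the Weierstrass theorem makes their span rich enough to test against: this yields
  both the L2 contraction (hankel_nn_integral_sq_le), by duality, and inversion (hankel_inversion),
  because an integrable function is determined by its integrals against Gaussians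
  (gaussian_moments_determine).
\<close>


section \<open>The normalised Bessel function\<close>

text \<open>
  Coefficients of j_\<beta> as a power series in w = (x/2)^2.  The quotient of Gamma values is written as a
  Pochhammer symbol, which turns the recurrences of the coefficients into polynomial identities.
\<close>

definition bessel_coeff :: "real \<Rightarrow> nat \<Rightarrow> real" where
  "bessel_coeff \<beta> n = (-1) ^ n / (fact n * pochhammer (\<beta> + 1) n)"

definition bessel_series :: "real \<Rightarrow> real \<Rightarrow> real" where
  "bessel_series \<beta> w = (\<Sum>n. bessel_coeff \<beta> n * w ^ n)"

text \<open>
  The factor \<beta> + 1 exceeds 1/2 and all later factors exceed 1; hence the coefficients of j_\<beta> are
  dominated by twice those of the exponential series.
\<close>

lemma pochhammer_ge_half:
  fixes \<beta> :: real
  assumes "\<beta> > -1/2"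
  shows "pochhammer (\<beta> + 1) n \<ge> 1/2"
proof (induction n)
  case (Suc n)
  show ?case
  proof (cases n)
    case 0
    then show ?thesis using assms by simp
  next
    case (Suc m)
    have "1 / 2 * 1 \<le> pochhammer (\<beta> + 1) n * (\<beta> + 1 + real n)"
      using assms Suc.IH Suc by (intro mult_mono) auto
    then show ?thesis by (simp add: pochhammer_Suc)
  qed
qed auto

lemma abs_bessel_coeff_le:
  assumes "\<beta> > -1/2"
  shows "\<bar>bessel_coeff \<beta> n\<bar> \<le> 2 / fact n"
proof -
  note p = pochhammer_ge_half[OF assms, of n]
  have "\<bar>bessel_coeff \<beta> n\<bar> = 1 / (fact n * pochhammer (\<beta> + 1) n)"
    using p by (simp add: bessel_coeff_def abs_mult power_abs)
  also have "\<dots> \<le> 1 / (fact n * (1/2))"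
    using p by (intro divide_left_mono mult_left_mono mult_pos_pos) auto
  finally show ?thesis by simp
qed

lemma bessel_coeff_0 [simp]: "bessel_coeff \<beta> 0 = 1"
  by (simp add: bessel_coeff_def)

text \<open>
  The Bessel equation w J'' + (\<beta> + 1) J' + J = 0 in the variable w, read off on coefficients.
\<close>

lemma bessel_coeff_recurrence:
  assumes "\<beta> > -1/2"
  shows "(real n + 1) * (real n + \<beta> + 1) * bessel_coeff \<beta> (Suc n) = - bessel_coeff \<beta> n"
proof -
  have "pochhammer (\<beta> + 1) n \<noteq> 0" "real n + \<beta> + 1 \<noteq> 0"
    using pochhammer_ge_half[OF assms, of n] assms by auto
  then show ?thesis
    by (simp add: bessel_coeff_def pochhammer_Suc divide_simps) (simp add: algebra_simps)
qed

lemma summable_exp_real: "summable (\<lambda>n. (x::real) ^ n / fact n)"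
  using summable_exp[of x] by (simp add: field_simps)

lemma summable_abs_bessel:
  assumes "\<beta> > -1/2"
  shows "summable (\<lambda>n. \<bar>bessel_coeff \<beta> n * w ^ n\<bar>)"
proof (rule summable_comparison_test')
  show "summable (\<lambda>n. 2 * (\<bar>w\<bar> ^ n / fact n))"
    by (intro summable_mult summable_exp_real)
  show "norm \<bar>bessel_coeff \<beta> n * w ^ n\<bar> \<le> 2 * (\<bar>w\<bar> ^ n / fact n)" for n
    using mult_right_mono[OF abs_bessel_coeff_le[OF assms, of n], of "\<bar>w\<bar> ^ n"]
    by (simp add: abs_mult power_abs)
qed

lemma summable_bessel:
  assumes "\<beta> > -1/2"
  shows "summable (\<lambda>n. bessel_coeff \<beta> n * w ^ n)"
  by (rule summable_rabs_cancel[OF summable_abs_bessel[OF assms]])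

lemma bessel_j_eq_series:
  assumes "\<beta> > -1/2"
  shows "bessel_j \<beta> x = bessel_series \<beta> (x\<^sup>2 / 4)"
proof -
  have *: "Gamma (\<beta> + 1) * ((- 1) ^ n / (fact n * Gamma (real n + \<beta> + 1)) * (x / 2) ^ (2 * n))
      = bessel_coeff \<beta> n * (x\<^sup>2 / 4) ^ n" for n
  proof -
    have g: "Gamma (\<beta> + 1) > 0" using assms by (intro Gamma_real_pos) auto
    have nz: "\<beta> + 1 \<notin> \<int>\<^sub>\<le>\<^sub>0"
      using assms by (auto elim!: nonpos_Ints_cases)
    have "pochhammer (\<beta> + 1) n = Gamma (real n + \<beta> + 1) / Gamma (\<beta> + 1)"
      using pochhammer_Gamma[OF nz, of n] by (simp add: add_ac)
    moreover have "(x / 2) ^ (2 * n) = (x\<^sup>2 / 4) ^ n"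
      by (simp add: power_mult power_divide)
    ultimately show ?thesis using g by (simp add: bessel_coeff_def)
  qed
  have "summable (\<lambda>n. Gamma (\<beta> + 1) * ((- 1) ^ n / (fact n * Gamma (real n + \<beta> + 1)) * (x / 2) ^ (2 * n)))"
    unfolding * by (rule summable_bessel[OF assms])
  moreover have "Gamma (\<beta> + 1) \<noteq> 0"
    using Gamma_real_pos[of "\<beta> + 1"] assms by linarith
  ultimately have "summable (\<lambda>n. (- 1) ^ n / (fact n * Gamma (real n + \<beta> + 1)) * (x / 2) ^ (2 * n))"
    by (simp only: summable_cmult_iff simp_thms)
  from suminf_mult[OF this, of "Gamma (\<beta> + 1)"] show ?thesis
    unfolding bessel_j_def bessel_series_def * by simp
qed

text \<open>
  In the variable w the Bessel equation has no singularity at 0, and the energy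
  E = J^2 + w J'^2 satisfies E' = -(2 \<beta> + 1) J'^2 \<le> 0.  Therefore J^2 \<le> E \<le> E(0) = 1 on the half-line.
\<close>

lemma abs_bessel_series_le_one:
  assumes \<beta>: "\<beta> > -1/2" and w: "w \<ge> 0"
  shows "\<bar>bessel_series \<beta> w\<bar> \<le> 1"
proof -
  define c where "c = bessel_coeff \<beta>"
  define J where "J = bessel_series \<beta>"
  define J1 where "J1 = (\<lambda>w. \<Sum>n. diffs c n * w ^ n)"
  define J2 where "J2 = (\<lambda>w. \<Sum>n. diffs (diffs c) n * w ^ n)"
  have s0: "summable (\<lambda>n. c n * w ^ n)" for w
    unfolding c_def by (rule summable_bessel[OF \<beta>])
  have s1: "summable (\<lambda>n. diffs c n * w ^ n)" for w
    by (rule termdiff_converges_all[OF s0])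
  have s2: "summable (\<lambda>n. diffs (diffs c) n * w ^ n)" for w
    by (rule termdiff_converges_all[OF s1])
  have dJ: "(J has_real_derivative J1 w) (at w)" for w
    unfolding J_def J1_def bessel_series_def c_def[symmetric]
    by (rule termdiffs_strong_converges_everywhere[OF s0])
  have dJ1: "(J1 has_real_derivative J2 w) (at w)" for w
    unfolding J1_def J2_def by (rule termdiffs_strong_converges_everywhere[OF s1])
  have ode: "w * J2 w + (\<beta> + 1) * J1 w + J w = 0" for w
  proof -
    have "(\<lambda>n. diffs (diffs c) n * w ^ n * w) sums (J2 w * w)"
      unfolding J2_def by (intro sums_mult2 summable_sums s2)
    then have "(\<lambda>n. real (Suc n) * diffs c (Suc n) * w ^ Suc n) sums (w * J2 w)"
      by (simp add: diffs_def mult_ac)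
    then have "(\<lambda>n. real n * diffs c n * w ^ n) sums (w * J2 w)"
      by (subst (asm) sums_Suc_iff) simp
    moreover have "(\<lambda>n. (\<beta> + 1) * (diffs c n * w ^ n)) sums ((\<beta> + 1) * J1 w)"
      unfolding J1_def by (intro sums_mult summable_sums s1)
    moreover have "(\<lambda>n. c n * w ^ n) sums J w"
      unfolding J_def bessel_series_def c_def[symmetric] by (intro summable_sums s0)
    \<comment> \<open>The shifted series for w J'' puts all three series on the same powers of w.\<close>
    ultimately have "(\<lambda>n. real n * diffs c n * w ^ n + (\<beta> + 1) * (diffs c n * w ^ n) + c n * w ^ n)
        sums (w * J2 w + (\<beta> + 1) * J1 w + J w)"
      by (intro sums_add)
    moreover have "real n * diffs c n * w ^ n + (\<beta> + 1) * (diffs c n * w ^ n) + c n * w ^ n = 0" for n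
    proof -
      have "real n * diffs c n * w ^ n + (\<beta> + 1) * (diffs c n * w ^ n) + c n * w ^ n
          = ((real n + 1) * (real n + \<beta> + 1) * c (Suc n) + c n) * w ^ n"
        by (simp add: diffs_def algebra_simps)
      then show ?thesis unfolding c_def bessel_coeff_recurrence[OF \<beta>] by simp
    qed
    ultimately show ?thesis by (simp add: sums_iff)
  qed
  define E where "E = (\<lambda>w. (J w)\<^sup>2 + w * (J1 w)\<^sup>2)"
  have dE: "(E has_real_derivative - ((2 * \<beta> + 1) * (J1 w)\<^sup>2)) (at w)" for w
  proof -
    have "(E has_real_derivative (2 * J w * J1 w + ((J1 w)\<^sup>2 + w * (2 * J1 w * J2 w)))) (at w)"
      unfolding E_def by (auto intro!: derivative_eq_intros dJ dJ1 simp: algebra_simps)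
    also have "2 * J w * J1 w + ((J1 w)\<^sup>2 + w * (2 * J1 w * J2 w))
        = 2 * J1 w * (w * J2 w + (\<beta> + 1) * J1 w + J w) - (2 * \<beta> + 1) * (J1 w)\<^sup>2"
      by (simp add: algebra_simps power2_eq_square)
    finally show ?thesis unfolding ode by simp
  qed
  have "E w \<le> E 0"
    by (rule DERIV_nonpos_imp_nonincreasing[OF w])
       (use dE \<beta> in \<open>force intro!: exI mult_nonneg_nonneg\<close>)
  moreover have "E 0 = 1"
    unfolding E_def J_def bessel_series_def by (simp add: powser_zero)
  moreover have "(J w)\<^sup>2 \<le> E w" unfolding E_def using w by simp
  ultimately have "(J w)\<^sup>2 \<le> 1" by simp
  then show ?thesis unfolding J_def by (simp add: abs_square_le_1)
qed

lemma abs_bessel_j_le_one: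
  assumes "\<beta> > -1/2"
  shows "\<bar>bessel_j \<beta> x\<bar> \<le> 1"
  unfolding bessel_j_eq_series[OF assms] by (rule abs_bessel_series_le_one[OF assms]) simp

lemma continuous_on_bessel_j:
  assumes "\<beta> > -1/2"
  shows "continuous_on UNIV (bessel_j \<beta>)"
proof -
  have "isCont (bessel_series \<beta>) w" for w
    unfolding bessel_series_def
    by (rule DERIV_isCont[OF termdiffs_strong_converges_everywhere[OF summable_bessel[OF assms]]])
  then have "continuous_on UNIV (bessel_series \<beta>)"
    by (simp add: continuous_on_eq_continuous_at)
  then have "continuous_on UNIV (\<lambda>x. bessel_series \<beta> (x\<^sup>2 / 4))"
    by (rule continuous_on_compose2) (auto intro!: continuous_intros)
  then show ?thesis by (simp add: bessel_j_eq_series[OF assms])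
qed

section \<open>The measures and Gaussian integrals\<close>

definition mu_const :: "real \<Rightarrow> real" where
  "mu_const \<alpha> = 2 * pi powr (\<alpha> + 1) / Gamma (\<alpha> + 1)"

lemma mu_const_pos:
  assumes "\<alpha> > -1/2"
  shows "mu_const \<alpha> > 0"
  unfolding mu_const_def using assms by (intro divide_pos_pos Gamma_real_pos) auto

lemma mu_meas_eq:
  "mu_meas \<alpha> = density (lebesgue_on {0..}) (\<lambda>x. ennreal (mu_const \<alpha> * x powr (2 * \<alpha> + 1)))"
  by (simp add: mu_meas_def mu_const_def)

lemma space_mu_meas [simp]: "space (mu_meas \<alpha>) = {0..}"
  by (simp add: mu_meas_def)

lemma sets_mu_meas [measurable_cong, simp]: "sets (mu_meas \<alpha>) = sets (lebesgue_on {0..})"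
  by (simp add: mu_meas_def)

lemma measurable_lebesgue_on_borel:
  "f \<in> borel \<rightarrow>\<^sub>M N \<Longrightarrow> f \<in> lebesgue_on S \<rightarrow>\<^sub>M N"
  by (intro measurable_restrict_space1 measurable_completion) (simp only: measurable_lborel2)

lemma measurable_mu_meas_borel:
  assumes "f \<in> borel \<rightarrow>\<^sub>M N"
  shows "f \<in> mu_meas \<alpha> \<rightarrow>\<^sub>M N"
  using measurable_lebesgue_on_borel[OF assms, of "{0..}"]
  by (simp cong: measurable_cong_sets)

lemma measurable_mu_weight:
  "(\<lambda>x. c * x powr a) \<in> borel_measurable (lebesgue_on {0..})" for c a :: real
  by (rule measurable_lebesgue_on_borel) measurable

text \<open>
  Needed for Fubini and for deducing that a function vanishes from its integrals over sets.
\<close>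

lemma sigma_finite_mu_meas: "sigma_finite_measure (mu_meas \<alpha>)"
proof -
  have "sigma_finite_measure (lebesgue :: real measure)"
  proof
    have "countable (range (\<lambda>n::nat. cball 0 (real n) :: real set))"
      "range (\<lambda>n::nat. cball 0 (real n) :: real set) \<subseteq> sets lebesgue"
      "\<Union> (range (\<lambda>n::nat. cball 0 (real n) :: real set)) = space lebesgue"
      "\<forall>a\<in>range (\<lambda>n::nat. cball 0 (real n) :: real set). emeasure lebesgue a \<noteq> \<infinity>"
      using real_arch_simple by (auto simp: emeasure_cball)
    then show "\<exists>A. countable A \<and> A \<subseteq> sets lebesgue \<and> \<Union> A = space lebesgue \<and>
        (\<forall>a\<in>A. emeasure (lebesgue :: real measure) a \<noteq> \<infinity>)"
      by blast
  qed
  then interpret sigma_finite_measure "lebesgue_on {0..} :: real measure"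
    by (rule sigma_finite_measure_restrict_space) auto
  show ?thesis
    unfolding mu_meas_eq
    by (subst sigma_finite_iff_density_finite) (auto intro: measurable_compose[OF measurable_mu_weight])
qed

lemma integral_mu_meas:
  fixes f :: "real \<Rightarrow> 'a::{banach, second_countable_topology}"
  assumes "\<alpha> > -1/2" "f \<in> borel_measurable (mu_meas \<alpha>)"
  shows "integrable (mu_meas \<alpha>) f \<longleftrightarrow>
           integrable (lebesgue_on {0..}) (\<lambda>x. (mu_const \<alpha> * x powr (2 * \<alpha> + 1)) *\<^sub>R f x)"
    and "integral\<^sup>L (mu_meas \<alpha>) f =
           (\<integral>x. (mu_const \<alpha> * x powr (2 * \<alpha> + 1)) *\<^sub>R f x \<partial>lebesgue_on {0..})"
proof -
  have f: "f \<in> borel_measurable (lebesgue_on {0..})"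
    using assms(2) by (simp cong: measurable_cong_sets)
  have nn: "AE x in lebesgue_on {0..}. 0 \<le> mu_const \<alpha> * x powr (2 * \<alpha> + 1)"
    using mu_const_pos[OF assms(1)] by auto
  show "integrable (mu_meas \<alpha>) f \<longleftrightarrow>
           integrable (lebesgue_on {0..}) (\<lambda>x. (mu_const \<alpha> * x powr (2 * \<alpha> + 1)) *\<^sub>R f x)"
    unfolding mu_meas_eq by (rule integrable_density[OF f measurable_mu_weight nn])
  show "integral\<^sup>L (mu_meas \<alpha>) f =
           (\<integral>x. (mu_const \<alpha> * x powr (2 * \<alpha> + 1)) *\<^sub>R f x \<partial>lebesgue_on {0..})"
    unfolding mu_meas_eq by (rule integral_density[OF f measurable_mu_weight nn])
qed

text \<open>
  Substituting t = c x^2 in the Euler integral for Gamma.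
\<close>

lemma gaussian_power_integral:
  fixes p c :: real
  assumes p: "p > 0" and c: "c > 0"
  shows "integrable (lebesgue_on {0..}) (\<lambda>x. x powr (2 * p - 1) * exp (- c * x\<^sup>2))"
    and "(\<integral>x. x powr (2 * p - 1) * exp (- c * x\<^sup>2) \<partial>lebesgue_on {0..}) = Gamma p / (2 * c powr p)"
proof -
  define h where "h = (\<lambda>t::real. t powr (p - 1) / exp t)"
  have h: "(h has_integral Gamma p) {0..}"
    unfolding h_def by (rule Gamma_integral_real[OF p])
  have "h absolutely_integrable_on {0..}"
    by (rule nonnegative_absolutely_integrable_1)
       (use h in \<open>auto simp: h_def has_integral_iff\<close>)
  then have ha: "h absolutely_integrable_on {0<..}"
    by (rule set_integrable_subset) auto
  \<comment> \<open>The substitution is done on the open half-line, the other integrals are taken over the closed one.\<close>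
  have sp: "negligible {x \<in> {0<..} - {0..}. k x \<noteq> 0}" "negligible {x \<in> {0..} - {0<..}. k x \<noteq> 0}"
    for k :: "real \<Rightarrow> real"
    by (rule negligible_subset[of "{0}"]; force)+
  have hi: "integral {0<..} h = Gamma p"
    using h integral_spike_set[OF sp[of h]] by (simp add: has_integral_iff)
  have img: "(\<lambda>x. c * x\<^sup>2) ` {0<..} = {0<..}"
  proof (intro equalityI subsetI)
    fix y :: real assume "y \<in> {0<..}"
    then have "y = c * (sqrt (y / c))\<^sup>2" "sqrt (y / c) \<in> {0<..}" using c by auto
    then show "y \<in> (\<lambda>x. c * x\<^sup>2) ` {0<..}" by blast
  qed (use c in auto)
  have inj: "inj_on (\<lambda>x. c * x\<^sup>2) {0<..}"
    using c by (auto simp: inj_on_def)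
  have *: "(\<lambda>x. \<bar>2 * c * x\<bar> * h (c * x\<^sup>2)) absolutely_integrable_on {0<..} \<and>
      integral {0<..} (\<lambda>x. \<bar>2 * c * x\<bar> * h (c * x\<^sup>2)) = Gamma p"
    by (subst has_absolute_integral_change_of_variables_1'[OF _ _ inj])
       (use ha hi in \<open>auto simp: img intro!: derivative_eq_intros\<close>)
  define g where "g = (\<lambda>x. x powr (2 * p - 1) * exp (- c * x\<^sup>2))"
  have eq: "\<bar>2 * c * x\<bar> * h (c * x\<^sup>2) = (2 * c powr p) * g x" if "x \<in> {0<..}" for x
  proof -
    have "x > 0" using that by simp
    then have "(c * x\<^sup>2) powr (p - 1) = c powr (p - 1) * x powr (2 * p - 2)"
    proof -
      have "(x\<^sup>2) powr (p - 1) = (x powr 2) powr (p - 1)" using \<open>x > 0\<close> by simp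
      also have "\<dots> = x powr (2 * p - 2)" by (simp only: powr_powr) (simp add: algebra_simps)
      finally show ?thesis using c by (simp add: powr_mult)
    qed
    moreover have "c powr p = c * c powr (p - 1)" using c by (simp add: powr_mult_base)
    moreover have "x powr (2 * p - 1) = x * x powr (2 * p - 2)" 
      using \<open>x > 0\<close> powr_mult_base[of x "2*p-2"] by simp
    ultimately show ?thesis
      using \<open>x > 0\<close> c by (simp add: h_def g_def exp_minus abs_mult field_simps)
  qed
  have ga: "(\<lambda>x. (2 * c powr p) * g x) absolutely_integrable_on {0<..}"
    using * by (subst set_integrable_cong[OF refl refl eq[symmetric]]) auto
  have gi: "integral {0<..} (\<lambda>x. (2 * c powr p) * g x) = Gamma p"
    using * Henstock_Kurzweil_Integration.integral_cong
      [of "{0<..}" "\<lambda>x. \<bar>2 * c * x\<bar> * h (c * x\<^sup>2)" "\<lambda>x. (2 * c powr p) * g x", OF eq] by simp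
  have "g absolutely_integrable_on {0<..}"
    using ga c by (subst (asm) set_integrable_mult_right_iff) auto
  then have "g absolutely_integrable_on {0..}"
    by (simp only: absolutely_integrable_spike_set_eq[OF sp])
  then show A: "integrable (lebesgue_on {0..}) (\<lambda>x. x powr (2 * p - 1) * exp (- c * x\<^sup>2))"
    unfolding g_def[symmetric] by (simp add: integrable_restrict_space set_integrable_def)
  have "integral {0..} g = integral {0<..} g"
    by (rule integral_spike_set[OF sp, symmetric])
  also have "\<dots> = Gamma p / (2 * c powr p)"
    using gi c by (simp add: field_simps)
  finally show "(\<integral>x. x powr (2 * p - 1) * exp (- c * x\<^sup>2) \<partial>lebesgue_on {0..}) = Gamma p / (2 * c powr p)"
    unfolding g_def using lebesgue_integral_eq_integral[OF A] by simp
qed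

text \<open>
  The weight of the measure only raises the exponent of x, so this is the integral above with
  p = n + \<alpha> + 1; the Gamma value it produces is cancelled, up to a Pochhammer symbol, by the one in
  the normalising constant.
\<close>

lemma gaussian_moment:
  fixes \<alpha> s :: real
  assumes \<alpha>: "\<alpha> > -1/2" and s: "s > 0"
  shows "integrable (mu_meas \<alpha>) (\<lambda>x. x ^ (2 * n) * exp (- pi * s * x\<^sup>2))"
    and "(\<integral>x. x ^ (2 * n) * exp (- pi * s * x\<^sup>2) \<partial>mu_meas \<alpha>)
           = pochhammer (\<alpha> + 1) n / (pi * s) ^ n * s powr - (\<alpha> + 1)"
proof -
  let ?f = "\<lambda>x. x ^ (2 * n) * exp (- pi * s * x\<^sup>2)"
  define p where "p = real n + \<alpha> + 1"
  have p: "p > 0" using \<alpha> by (simp add: p_def)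
  note G = gaussian_power_integral[OF p, of "pi * s"]
  have m: "?f \<in> borel_measurable (mu_meas \<alpha>)"
    by (rule measurable_mu_meas_borel) measurable
  have eq: "(mu_const \<alpha> * x powr (2 * \<alpha> + 1)) *\<^sub>R ?f x =
      mu_const \<alpha> * (x powr (2 * p - 1) * exp (- (pi * s) * x\<^sup>2))" if "x \<in> {0..}" for x
  proof (cases "x = 0")
    case False
    then have "x > 0" using that by simp
    then have "x powr (2 * \<alpha> + 1) * x ^ (2 * n) = x powr (2 * p - 1)"
      by (simp add: powr_realpow[symmetric] powr_add[symmetric] p_def algebra_simps)
    then show ?thesis by (simp add: mult_ac)
  qed auto
  show "integrable (mu_meas \<alpha>) ?f"
    using G(1) s unfolding integral_mu_meas(1)[OF \<alpha> m]
    by (subst Bochner_Integration.integrable_cong[OF refl eq]) auto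
  have "integral\<^sup>L (mu_meas \<alpha>) ?f
      = (\<integral>x. mu_const \<alpha> * (x powr (2 * p - 1) * exp (- (pi * s) * x\<^sup>2)) \<partial>lebesgue_on {0..})"
    unfolding integral_mu_meas(2)[OF \<alpha> m]
    by (rule Bochner_Integration.integral_cong[OF refl eq]) simp
  also have "\<dots> = mu_const \<alpha> * (Gamma p / (2 * (pi * s) powr p))"
    using G(2) s by simp
  also have "\<dots> = pochhammer (\<alpha> + 1) n / (pi * s) ^ n * s powr - (\<alpha> + 1)"
  proof -
    have nz: "\<alpha> + 1 \<notin> \<int>\<^sub>\<le>\<^sub>0" using \<alpha> by (auto elim!: nonpos_Ints_cases)
    have g: "Gamma (\<alpha> + 1) > 0" using \<alpha> by (intro Gamma_real_pos) auto
    have "Gamma p = pochhammer (\<alpha> + 1) n * Gamma (\<alpha> + 1)"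
      using pochhammer_Gamma[OF nz, of n] g by (simp add: p_def add_ac)
    moreover have "(pi * s) powr p = (pi * s) ^ n * pi powr (\<alpha> + 1) * s powr (\<alpha> + 1)"
    proof -
      have "(pi * s) powr p = (pi * s) powr real n * (pi * s) powr (\<alpha> + 1)"
        unfolding p_def by (simp add: powr_add[symmetric] add_ac)
      then show ?thesis using s by (simp add: powr_realpow powr_mult power_mult_distrib)
    qed
    ultimately show ?thesis
      unfolding powr_minus using g s by (simp add: mu_const_def field_simps)
  qed
  finally show "integral\<^sup>L (mu_meas \<alpha>) ?f
      = pochhammer (\<alpha> + 1) n / (pi * s) ^ n * s powr - (\<alpha> + 1)" .
qed

lemma gaussian_integral:
  fixes \<alpha> s :: real
  assumes "\<alpha> > -1/2" "s > 0"
  shows "integrable (mu_meas \<alpha>) (\<lambda>x. exp (- pi * s * x\<^sup>2))"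
    and "(\<integral>x. exp (- pi * s * x\<^sup>2) \<partial>mu_meas \<alpha>) = s powr - (\<alpha> + 1)"
  using gaussian_moment[OF assms, of 0] by simp_all

text \<open>
  Integrating the series of j_\<alpha> term by term, the Pochhammer symbol of the moment cancels the one in
  the coefficient and an exponential series remains.  The same computation with absolute values
  gives exp(\<pi> y^2 / s), which justifies the exchange.
\<close>

lemma gaussian_hankel:
  fixes \<alpha> s y :: real
  assumes \<alpha>: "\<alpha> > -1/2" and s: "s > 0"
  shows "(\<integral>x. exp (- pi * s * x\<^sup>2) * bessel_j \<alpha> (2 * pi * x * y) \<partial>mu_meas \<alpha>)
           = s powr - (\<alpha> + 1) * exp (- pi * y\<^sup>2 / s)"
proof -
  define t where "t n x = (bessel_coeff \<alpha> n * (pi\<^sup>2 * y\<^sup>2) ^ n) * (x ^ (2 * n) * exp (- pi * s * x\<^sup>2))"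
    for n and x :: real
  have int: "integrable (mu_meas \<alpha>) (t n)" for n
    unfolding t_def by (intro integrable_mult_right gaussian_moment(1)[OF \<alpha> s])
  have t_eq: "t n x = exp (- pi * s * x\<^sup>2) * (bessel_coeff \<alpha> n * ((2 * pi * x * y)\<^sup>2 / 4) ^ n)" for n x
  proof -
    have "(2 * pi * x * y)\<^sup>2 / 4 = (pi\<^sup>2 * y\<^sup>2) * x\<^sup>2"
      by (simp add: power_mult_distrib)
    then have "((2 * pi * x * y)\<^sup>2 / 4) ^ n = (pi\<^sup>2 * y\<^sup>2) ^ n * x ^ (2 * n)"
      by (simp only: power_mult_distrib power_mult)
    then show ?thesis by (simp add: t_def)
  qed
  have q: "pi\<^sup>2 * y\<^sup>2 / (pi * s) = pi * y\<^sup>2 / s"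
    using s by (simp add: power2_eq_square)
  have qn: "(pi\<^sup>2 * y\<^sup>2) ^ n / (pi * s) ^ n = (pi * y\<^sup>2 / s) ^ n" for n
    unfolding power_divide[symmetric] q ..
  have pn: "pochhammer (\<alpha> + 1) n > 0" for n
    using pochhammer_ge_half[OF \<alpha>, of n] by linarith
  have I: "integral\<^sup>L (mu_meas \<alpha>) (t n) = s powr - (\<alpha> + 1) * ((- (pi * y\<^sup>2 / s)) ^ n / fact n)" for n
  proof -
    have "integral\<^sup>L (mu_meas \<alpha>) (t n) = bessel_coeff \<alpha> n * (pi\<^sup>2 * y\<^sup>2) ^ n *
        (pochhammer (\<alpha> + 1) n / (pi * s) ^ n * s powr - (\<alpha> + 1))"
      unfolding t_def using gaussian_moment(2)[OF \<alpha> s, of n] by simp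
    also have "\<dots> = (bessel_coeff \<alpha> n * pochhammer (\<alpha> + 1) n) * ((pi\<^sup>2 * y\<^sup>2) ^ n / (pi * s) ^ n) * s powr - (\<alpha> + 1)"
      by simp
    also have "bessel_coeff \<alpha> n * pochhammer (\<alpha> + 1) n = (-1) ^ n / fact n"
      using pn[of n] by (simp add: bessel_coeff_def)
    finally show ?thesis unfolding qn by (subst power_minus) simp
  qed
  \<comment> \<open>All coefficients of t n have the sign (-1)^n, so the norm integrates to the same value without sign.\<close>
  have N: "(\<integral>x. norm (t n x) \<partial>mu_meas \<alpha>) = s powr - (\<alpha> + 1) * ((pi * y\<^sup>2 / s) ^ n / fact n)" for n
  proof -
    have "(\<integral>x. norm (t n x) \<partial>mu_meas \<alpha>) = (\<integral>x. (-1) ^ n * t n x \<partial>mu_meas \<alpha>)"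
      using pn[of n]
      by (intro Bochner_Integration.integral_cong)
         (auto simp: t_def abs_mult bessel_coeff_def power_abs)
    then show ?thesis
      using I[of n] by (simp add: power_minus[of "pi * y\<^sup>2 / s"])
  qed
  have "(\<lambda>n. integral\<^sup>L (mu_meas \<alpha>) (t n)) sums (\<integral>x. (\<Sum>n. t n x) \<partial>mu_meas \<alpha>)"
  proof (rule sums_integral[OF int])
    show "AE x in mu_meas \<alpha>. summable (\<lambda>n. norm (t n x))"
    proof (rule AE_I2)
      fix x
      show "summable (\<lambda>n. norm (t n x))"
        unfolding t_eq real_norm_def abs_mult[of "exp _"]
        by (intro summable_mult summable_abs_bessel[OF \<alpha>])
    qed
    show "summable (\<lambda>n. \<integral>x. norm (t n x) \<partial>mu_meas \<alpha>)"
      unfolding N by (intro summable_mult summable_exp_real)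
  qed
  moreover have "(\<Sum>n. t n x) = exp (- pi * s * x\<^sup>2) * bessel_j \<alpha> (2 * pi * x * y)" for x
    unfolding t_eq bessel_j_eq_series[OF \<alpha>] bessel_series_def
    by (rule suminf_mult[OF summable_bessel[OF \<alpha>]])
  moreover have "(\<lambda>n. integral\<^sup>L (mu_meas \<alpha>) (t n)) sums (s powr - (\<alpha> + 1) * exp (- (pi * y\<^sup>2 / s)))"
    unfolding I using exp_converges[of "- (pi * y\<^sup>2 / s)"]
    by (intro sums_mult) (simp add: field_simps)
  ultimately show ?thesis by (simp add: sums_iff)
qed

section \<open>The transform of real functions\<close>

text \<open>
  The Fourier-Bessel transform on real-valued functions.  The kernel is real, so the complex transform
  acts separately on real and imaginary parts, and approximation arguments can be carried out over
  the reals.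
\<close>

definition hankel :: "real \<Rightarrow> (real \<Rightarrow> real) \<Rightarrow> real \<Rightarrow> real" where
  "hankel \<alpha> f y = (\<integral>x. f x * bessel_j \<alpha> (2 * pi * x * y) \<partial>mu_meas \<alpha>)"

lemma borel_measurable_bessel_j:
  assumes "\<beta> > -1/2"
  shows "bessel_j \<beta> \<in> borel_measurable borel"
  by (rule borel_measurable_continuous_onI[OF continuous_on_bessel_j[OF assms]])

lemma measurable_bessel_kernel:
  assumes "\<beta> > -1/2"
  shows "(\<lambda>x. bessel_j \<beta> (2 * pi * x * y)) \<in> borel_measurable (mu_meas \<alpha>)"
  by (rule measurable_mu_meas_borel, rule measurable_compose[OF _ borel_measurable_bessel_j[OF assms]]) measurable

lemma integrable_bessel_kernel:
  assumes "\<alpha> > -1/2" "integrable (mu_meas \<alpha>) f"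
  shows "integrable (mu_meas \<alpha>) (\<lambda>x. f x * bessel_j \<alpha> (2 * pi * x * y))"
proof (rule Bochner_Integration.integrable_bound[OF assms(2)])
  show "(\<lambda>x. f x * bessel_j \<alpha> (2 * pi * x * y)) \<in> borel_measurable (mu_meas \<alpha>)"
    using assms(2) measurable_bessel_kernel[OF assms(1)] by (intro borel_measurable_times) auto
  show "AE x in mu_meas \<alpha>. norm (f x * bessel_j \<alpha> (2 * pi * x * y)) \<le> norm (f x)"
    using abs_bessel_j_le_one[OF assms(1)] by (auto simp: abs_mult mult_left_le)
qed

lemma abs_hankel_le:
  assumes "\<alpha> > -1/2" "integrable (mu_meas \<alpha>) f"
  shows "\<bar>hankel \<alpha> f y\<bar> \<le> (\<integral>x. \<bar>f x\<bar> \<partial>mu_meas \<alpha>)"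
proof -
  have "norm (hankel \<alpha> f y) \<le> (\<integral>x. norm (f x * bessel_j \<alpha> (2 * pi * x * y)) \<partial>mu_meas \<alpha>)"
    unfolding hankel_def by (rule integral_norm_bound)
  also have "\<dots> \<le> (\<integral>x. \<bar>f x\<bar> \<partial>mu_meas \<alpha>)"
    using assms abs_bessel_j_le_one[OF assms(1)]
    by (intro integral_mono integrable_norm integrable_bessel_kernel)
       (auto simp: abs_mult mult_left_le)
  finally show ?thesis by simp
qed

text \<open>
  The kernel is continuous and bounded by 1, so f dominates.
\<close>

lemma continuous_on_hankel:
  assumes \<alpha>: "\<alpha> > -1/2" and f: "integrable (mu_meas \<alpha>) f"
  shows "continuous_on UNIV (hankel \<alpha> f)"
proof -
  have "isCont (hankel \<alpha> f) y" for y
    unfolding continuous_at_sequentially comp_def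
  proof (intro allI impI)
    fix Y :: "nat \<Rightarrow> real" assume Y: "Y \<longlonglongrightarrow> y"
    show "(\<lambda>n. hankel \<alpha> f (Y n)) \<longlonglongrightarrow> hankel \<alpha> f y"
      unfolding hankel_def
    proof (rule integral_dominated_convergence[where w = "\<lambda>x. \<bar>f x\<bar>"])
      show "AE x in mu_meas \<alpha>. (\<lambda>n. f x * bessel_j \<alpha> (2 * pi * x * Y n))
              \<longlonglongrightarrow> f x * bessel_j \<alpha> (2 * pi * x * y)"
      proof (rule AE_I2)
        fix x
        have "isCont (bessel_j \<alpha>) z" for z
          using continuous_on_bessel_j[OF \<alpha>] by (simp add: continuous_on_eq_continuous_at)
        then show "(\<lambda>n. f x * bessel_j \<alpha> (2 * pi * x * Y n)) \<longlonglongrightarrow> f x * bessel_j \<alpha> (2 * pi * x * y)"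
          by (intro tendsto_intros isCont_tendsto_compose[of _ "bessel_j \<alpha>"] Y)
      qed
      show "AE x in mu_meas \<alpha>. norm (f x * bessel_j \<alpha> (2 * pi * x * Y n)) \<le> \<bar>f x\<bar>" for n
        using abs_bessel_j_le_one[OF \<alpha>] by (auto simp: abs_mult mult_left_le)
      show "integrable (mu_meas \<alpha>) (\<lambda>x. \<bar>f x\<bar>)" using f by auto
    qed (use integrable_bessel_kernel[OF \<alpha> f] in auto)
  qed
  then show ?thesis by (simp add: continuous_on_eq_continuous_at)
qed

lemma borel_measurable_hankel:
  assumes "\<alpha> > -1/2" "integrable (mu_meas \<alpha>) f"
  shows "hankel \<alpha> f \<in> borel_measurable (mu_meas \<beta>)"
  by (intro measurable_mu_meas_borel borel_measurable_continuous_onI continuous_on_hankel assms)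

text \<open>
  Fubini for f(x) g(y) j(2 \<pi> x y), whose kernel is symmetric in x and y and bounded by 1.
\<close>

lemma hankel_swap:
  assumes \<alpha>: "\<alpha> > -1/2" and f: "integrable (mu_meas \<alpha>) f" and g: "integrable (mu_meas \<alpha>) g"
  shows "(\<integral>x. f x * hankel \<alpha> g x \<partial>mu_meas \<alpha>) = (\<integral>y. hankel \<alpha> f y * g y \<partial>mu_meas \<alpha>)"
proof -
  let ?M = "mu_meas \<alpha>"
  interpret sigma_finite_measure ?M by (rule sigma_finite_mu_meas)
  interpret pair_sigma_finite ?M ?M ..
  let ?j = "\<lambda>x y. bessel_j \<alpha> (2 * pi * x * y)"
  let ?k = "\<lambda>x y. f x * g y * ?j x y"
  have [measurable]: "f \<in> borel_measurable ?M" "g \<in> borel_measurable ?M" using f g by auto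
  have [measurable]: "(\<lambda>x. x) \<in> borel_measurable ?M"
    by (rule measurable_mu_meas_borel) measurable
  have jm: "(\<lambda>p. ?j (fst p) (snd p)) \<in> borel_measurable (?M \<Otimes>\<^sub>M ?M)"
    by (rule measurable_compose[OF _ borel_measurable_bessel_j[OF \<alpha>]]) measurable
  have m: "case_prod ?k \<in> borel_measurable (?M \<Otimes>\<^sub>M ?M)"
    using jm unfolding split_beta' by measurable
  have le: "norm (?k x y) \<le> \<bar>f x\<bar> * \<bar>g y\<bar>" for x y
    using abs_bessel_j_le_one[OF \<alpha>, of "2 * pi * x * y"] by (auto simp: abs_mult mult_left_le)
  have fg: "integrable (?M \<Otimes>\<^sub>M ?M) (\<lambda>p. f (fst p) * g (snd p))"
  proof (rule Fubini_integrable)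
    show "integrable ?M (\<lambda>x. \<integral>y. norm (f (fst (x, y)) * g (snd (x, y))) \<partial>?M)"
      using f by (simp add: abs_mult)
    show "AE x in ?M. integrable ?M (\<lambda>y. f (fst (x, y)) * g (snd (x, y)))"
      using g by simp
  qed measurable
  have int: "integrable (?M \<Otimes>\<^sub>M ?M) (case_prod ?k)"
    by (rule Bochner_Integration.integrable_bound[OF fg m]) (use le in \<open>auto simp: abs_mult\<close>)
  have fx: "f x * hankel \<alpha> g x = (\<integral>y. ?k x y \<partial>?M)" for x
  proof -
    have "f x * hankel \<alpha> g x = (\<integral>y. f x * (g y * bessel_j \<alpha> (2 * pi * y * x)) \<partial>?M)"
      unfolding hankel_def by (rule integral_mult_right_zero[symmetric])
    also have "\<dots> = (\<integral>y. ?k x y \<partial>?M)"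
      by (intro Bochner_Integration.integral_cong refl) (simp add: mult_ac)
    finally show ?thesis .
  qed
  have gy: "(\<integral>x. ?k x y \<partial>?M) = hankel \<alpha> f y * g y" for y
  proof -
    have "hankel \<alpha> f y * g y = (\<integral>x. f x * bessel_j \<alpha> (2 * pi * x * y) * g y \<partial>?M)"
      unfolding hankel_def by (rule integral_mult_left_zero[symmetric])
    also have "\<dots> = (\<integral>x. ?k x y \<partial>?M)"
      by (intro Bochner_Integration.integral_cong refl) (simp add: mult_ac)
    finally show ?thesis by simp
  qed
  show ?thesis
    unfolding fx gy[symmetric] using integral_fst[OF int] integral_snd[OF int] by simp
qed

definition gauss :: "real \<Rightarrow> real \<Rightarrow> real" where
  "gauss s x = exp (- pi * s * x\<^sup>2)"

lemma gauss_mult: "gauss s x * gauss t x = gauss (s + t) x"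
  by (simp add: gauss_def algebra_simps flip: exp_add)

lemma gauss_power: "gauss s x ^ n = gauss (real n * s) x"
  by (simp add: gauss_def algebra_simps flip: exp_of_nat_mult)

lemma gauss_nonneg [simp]: "gauss s x \<ge> 0" and gauss_pos: "gauss s x > 0"
  by (simp_all add: gauss_def)

lemma gauss_le_one: "s \<ge> 0 \<Longrightarrow> gauss s x \<le> 1"
  by (simp add: gauss_def mult_nonneg_nonneg)

lemma borel_measurable_gauss: "gauss s \<in> borel_measurable borel"
  unfolding gauss_def by measurable

lemma measurable_gauss_mu: "gauss s \<in> borel_measurable (mu_meas \<alpha>)"
  by (rule measurable_mu_meas_borel[OF borel_measurable_gauss])

lemma integrable_gauss:
  assumes "\<alpha> > -1/2" "s > 0"
  shows "integrable (mu_meas \<alpha>) (gauss s)"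
  using gaussian_integral(1)[OF assms] by (simp add: gauss_def[abs_def])

lemma integral_gauss:
  assumes "\<alpha> > -1/2" "s > 0"
  shows "integral\<^sup>L (mu_meas \<alpha>) (gauss s) = s powr - (\<alpha> + 1)"
  using gaussian_integral(2)[OF assms] by (simp add: gauss_def[abs_def])

lemma hankel_gauss:
  assumes "\<alpha> > -1/2" "s > 0"
  shows "hankel \<alpha> (gauss s) y = s powr - (\<alpha> + 1) * gauss (1 / s) y"
  using gaussian_hankel[OF assms, of y] by (simp add: hankel_def gauss_def)

section \<open>Gaussians separate integrable functions\<close>

lemma gauss_le_iff:
  assumes "x \<ge> 0" "y \<ge> 0"
  shows "gauss 1 x \<le> gauss 1 y \<longleftrightarrow> y \<le> x"
proof -
  have "pi * y\<^sup>2 \<le> pi * x\<^sup>2 \<longleftrightarrow> y\<^sup>2 \<le> x\<^sup>2"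
    by (rule mult_le_cancel_left_pos) simp
  then show ?thesis
    using assms by (simp add: gauss_def power_mono_iff)
qed

lemma real_polynomial_approximation:
  fixes \<Phi> :: "real \<Rightarrow> real"
  assumes "compact S" "continuous_on S \<Phi>" "e > 0"
  obtains a N where "\<And>v. v \<in> S \<Longrightarrow> \<bar>\<Phi> v - (\<Sum>i\<le>N. a i * v ^ i)\<bar> < e"
proof -
  obtain p where "real_polynomial_function p" "\<And>v. v \<in> S \<Longrightarrow> \<bar>\<Phi> v - p v\<bar> < e"
    using Stone_Weierstrass_real_polynomial_function[OF assms] by blast
  then show ?thesis
    using that unfolding real_polynomial_function_iff_sum by blast
qed

lemma integrable_mult_bounded:
  fixes G h :: "'a \<Rightarrow> real"
  assumes G: "integrable M G" and h: "h \<in> borel_measurable M"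
    and le: "\<And>x. x \<in> space M \<Longrightarrow> \<bar>h x\<bar> \<le> B"
  shows "integrable M (\<lambda>x. G x * h x)"
proof (rule Bochner_Integration.integrable_bound[of M "\<lambda>x. B * G x"])
  show "(\<lambda>x. G x * h x) \<in> borel_measurable M"
    using G h by (intro borel_measurable_times) auto
  show "AE x in M. norm (G x * h x) \<le> norm (B * G x)"
  proof (rule AE_I2)
    fix x assume "x \<in> space M"
    then have "\<bar>h x\<bar> \<le> \<bar>B\<bar>" using le[of x] by linarith
    then show "norm (G x * h x) \<le> norm (B * G x)"
      using mult_right_mono[of "\<bar>h x\<bar>" "\<bar>B\<bar>" "\<bar>G x\<bar>"] by (simp add: abs_mult mult.commute)
  qed
qed (use G in simp)

text \<open>
  The Gaussians with natural parameter n are the powers of v = exp(-\<pi> x^2), so G is orthogonal to every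
  polynomial in v, and by uniform approximation on [0,1] to every continuous function of v.
\<close>

lemma integral_continuous_gauss_eq_zero:
  assumes G: "integrable (mu_meas \<alpha>) G"
    and mom: "\<And>n::nat. (\<integral>x. G x * gauss (real n) x \<partial>mu_meas \<alpha>) = 0"
    and \<Phi>: "continuous_on UNIV \<Phi>"
  shows "(\<integral>x. G x * \<Phi> (gauss 1 x) \<partial>mu_meas \<alpha>) = 0"
proof -
  let ?M = "mu_meas \<alpha>"
  define X where "X = (\<integral>x. G x * \<Phi> (gauss 1 x) \<partial>?M)"
  define I where "I = (\<integral>x. \<bar>G x\<bar> \<partial>?M)"
  have I: "I \<ge> 0" unfolding I_def by (intro integral_nonneg_AE) auto
  have g01: "gauss 1 x \<in> {0..1}" for x using gauss_le_one[of 1 x] by simp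
  have "bounded (\<Phi> ` {0..1})"
    by (intro compact_imp_bounded compact_continuous_image continuous_on_subset[OF \<Phi>]) auto
  then obtain B where "\<forall>y \<in> \<Phi> ` {0..1}. norm y \<le> B"
    unfolding bounded_iff by blast
  then have B: "\<bar>\<Phi> v\<bar> \<le> B" if "v \<in> {0..1}" for v using that by simp
  have mphi: "(\<lambda>x. \<Phi> (gauss 1 x)) \<in> borel_measurable ?M"
    by (rule measurable_compose[OF measurable_gauss_mu borel_measurable_continuous_onI[OF \<Phi>]])
  have iphi: "integrable ?M (\<lambda>x. G x * \<Phi> (gauss 1 x))"
    by (rule integrable_mult_bounded[OF G mphi]) (rule B[OF g01])
  have ig: "integrable ?M (\<lambda>x. G x * gauss (real i) x)" for i
    by (rule integrable_mult_bounded[OF G measurable_gauss_mu, where B = 1])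
       (simp add: gauss_le_one)
  have est: "\<bar>X\<bar> \<le> e * I" if e: "e > 0" for e
  proof -
    obtain a N where aN: "\<And>v. v \<in> {0..1} \<Longrightarrow> \<bar>\<Phi> v - (\<Sum>i\<le>N. a i * v ^ i)\<bar> < e"
      using real_polynomial_approximation[OF _ continuous_on_subset[OF \<Phi>] e, of "{0..1}"] by auto
    define P where "P = (\<lambda>x. \<Sum>i\<le>N. a i * (G x * gauss (real i) x))"
    have P: "integrable ?M P" unfolding P_def using ig by (intro Bochner_Integration.integrable_sum) auto
    have P0: "integral\<^sup>L ?M P = 0"
      unfolding P_def using ig mom by (subst Bochner_Integration.integral_sum) auto
    have Pe: "P x = G x * (\<Sum>i\<le>N. a i * gauss 1 x ^ i)" for x
      unfolding P_def gauss_power by (simp add: sum_distrib_left mult_ac)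
    have "X = (\<integral>x. G x * \<Phi> (gauss 1 x) - P x \<partial>?M)"
      unfolding X_def using iphi P P0 by simp
    also have "norm \<dots> \<le> (\<integral>x. norm (G x * \<Phi> (gauss 1 x) - P x) \<partial>?M)"
      by (rule integral_norm_bound)
    also have "\<dots> \<le> (\<integral>x. e * \<bar>G x\<bar> \<partial>?M)"
    proof (intro integral_mono integrable_norm Bochner_Integration.integrable_diff iphi P)
      show "integrable ?M (\<lambda>x. e * \<bar>G x\<bar>)" using G by simp
      fix x
      have "G x * \<Phi> (gauss 1 x) - P x = G x * (\<Phi> (gauss 1 x) - (\<Sum>i\<le>N. a i * gauss 1 x ^ i))"
        unfolding Pe by (simp add: algebra_simps)
      then show "norm (G x * \<Phi> (gauss 1 x) - P x) \<le> e * \<bar>G x\<bar>"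
        using mult_right_mono[OF less_imp_le[OF aN[OF g01[of x]]], of "\<bar>G x\<bar>"]
        by (simp add: abs_mult mult.commute)
    qed
    also have "\<dots> = e * I" unfolding I_def by simp
    finally show ?thesis by simp
  qed
  have "X = 0"
  proof (rule ccontr)
    assume "X \<noteq> 0"
    \<comment> \<open>The choice e = |X| / (I + 1) contradicts the estimate unless X = 0.\<close>
    then have "\<bar>X\<bar> \<le> \<bar>X\<bar> / (I + 1) * I" using I by (intro est) auto
    also have "\<dots> < \<bar>X\<bar>" using I \<open>X \<noteq> 0\<close> by (simp add: field_simps)
    finally show False by simp
  qed
  then show ?thesis by (simp add: X_def)
qed

lemma AE_mu_meas_lebesgue:
  assumes "AE x in lebesgue. P x"
  shows "AE x in mu_meas \<alpha>. P x"
proof -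
  have "AE x in lebesgue_on {0..}. P x"
    using assms by (subst AE_restrict_space_iff) auto
  then show ?thesis
    unfolding mu_meas_eq by (subst AE_density) (auto intro: measurable_compose[OF measurable_mu_weight])
qed

text \<open>
  On the half-line v = exp(-\<pi> x^2) is injective and decreasing, so the indicator of a ray x < r is a
  bounded limit of continuous functions of v.  Hence G has integral zero over all rays, over all
  Borel sets because the rays are a generator stable under intersection, and over all measurable
  sets because these are Borel up to a null set.
\<close>

lemma gaussian_moments_determine:
  assumes G: "integrable (mu_meas \<alpha>) G"
    and mom: "\<And>n::nat. (\<integral>x. G x * gauss (real n) x \<partial>mu_meas \<alpha>) = 0"
  shows "AE x in mu_meas \<alpha>. G x = 0"
proof -
  let ?M = "mu_meas \<alpha>"
  interpret sigma_finite_measure ?M by (rule sigma_finite_mu_meas)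
  let ?int = "\<lambda>A. \<integral>x. indicator A x * G x \<partial>?M"
  have ind: "integrable ?M (\<lambda>x. indicator A x * G x)" if "A \<in> sets borel" for A
  proof -
    have "(indicator A :: real \<Rightarrow> real) \<in> borel_measurable ?M"
      using that by (intro measurable_mu_meas_borel) auto
    from integrable_mult_bounded[OF G this, of 1] show ?thesis
      by (simp add: mult.commute indicator_def)
  qed
  have total: "integral\<^sup>L ?M G = 0"
    using mom[of 0] by (simp add: gauss_def)
  have ray: "?int {..<r} = 0" for r :: real
  proof (cases "r \<le> 0")
    case True
    then show ?thesis
      by (intro integral_eq_zero_AE AE_I2) (auto simp: indicator_def)
  next
    case False
    define c where "c = gauss 1 r"
    \<comment> \<open>These increase to the indicator of v > c, which is the condition x < r.\<close>
    define \<Phi> where "\<Phi> n v = min 1 (real n * max 0 (v - c))" for n and v :: real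
    have "(\<lambda>n. \<integral>x. G x * \<Phi> n (gauss 1 x) \<partial>?M) \<longlonglongrightarrow> ?int {..<r}"
    proof (rule integral_dominated_convergence[where w = "\<lambda>x. \<bar>G x\<bar>"])
      show "AE x in ?M. (\<lambda>n. G x * \<Phi> n (gauss 1 x)) \<longlonglongrightarrow> indicator {..<r} x * G x"
      proof (rule AE_I2)
        fix x assume "x \<in> space ?M"
        then have x: "x \<ge> 0" by simp
        have iff: "x < r \<longleftrightarrow> gauss 1 x > c"
          using gauss_le_iff[of x r] x False by (simp add: c_def not_le[symmetric])
        have "(\<lambda>n. \<Phi> n (gauss 1 x)) \<longlonglongrightarrow> indicator {..<r} x"
        proof (cases "x < r")
          case True
          then have d: "gauss 1 x - c > 0" using iff by simp
          obtain N :: nat where N: "1 / (gauss 1 x - c) < real N" using reals_Archimedean2 by blast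
          have "\<Phi> n (gauss 1 x) = 1" if "n \<ge> N" for n
          proof -
            have "1 / (gauss 1 x - c) \<le> real n" using N that by linarith
            then have "1 \<le> real n * (gauss 1 x - c)" using d by (simp add: field_simps)
            then show ?thesis using d by (simp add: \<Phi>_def max_def min_def)
          qed
          then show ?thesis
            using True by (intro tendsto_eventually eventually_sequentiallyI[of N]) simp
        next
          case False
          then have "\<Phi> n (gauss 1 x) = 0" for n
            using iff by (simp add: \<Phi>_def max_def)
          then show ?thesis using False by simp
        qed
        then show "(\<lambda>n. G x * \<Phi> n (gauss 1 x)) \<longlonglongrightarrow> indicator {..<r} x * G x"
          by (subst mult.commute) (rule tendsto_mult_left)
      qed
      show "AE x in ?M. norm (G x * \<Phi> n (gauss 1 x)) \<le> \<bar>G x\<bar>" for n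
        by (auto simp: \<Phi>_def abs_mult min_def max_def intro!: mult_left_le)
      have "\<Phi> n \<in> borel_measurable borel" for n
        unfolding \<Phi>_def by measurable
      then show "(\<lambda>x. G x * \<Phi> n (gauss 1 x)) \<in> borel_measurable ?M" for n
        using G by (intro borel_measurable_times measurable_compose[OF measurable_gauss_mu]) auto
    qed (use G ind[of "{..<r}"] in auto)
    moreover have "(\<integral>x. G x * \<Phi> n (gauss 1 x) \<partial>?M) = 0" for n
      unfolding \<Phi>_def by (intro integral_continuous_gauss_eq_zero[OF G mom] continuous_intros)
    ultimately show ?thesis by (simp add: LIMSEQ_const_iff)
  qed
  have borel: "?int A = 0" if "A \<in> sets borel" for A
  proof -
    have eq: "sets (borel :: real measure) = sigma_sets UNIV (range lessThan)"
      unfolding borel_Iio by simp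
    have stable: "Int_stable (range lessThan :: real set set)"
    proof (rule Int_stableI, clarify)
      fix a b :: real
      show "{..<a} \<inter> {..<b} \<in> range lessThan"
        by (rule range_eqI[of _ _ "min a b"]) auto
    qed
    have "A \<in> sigma_sets UNIV (range lessThan)" using that eq by simp
    with stable subset_UNIV[of "range lessThan", folded Pow_UNIV] show ?thesis
    proof (induction rule: sigma_sets_induct_disjoint)
      case (basic A)
      then show ?case using ray by auto
    next
      case empty
      show ?case by simp
    next
      case (compl A)
      have "?int (UNIV - A) = (\<integral>x. G x - indicator A x * G x \<partial>?M)"
        by (intro Bochner_Integration.integral_cong) (auto simp: indicator_def)
      also have "\<dots> = 0"
        using compl ind[of A] G total eq by simp
      finally show ?case .
    next
      case (union A)
      have m: "A i \<in> sets borel" for i using union(2) eq by auto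
      have "(\<lambda>i. ?int (A i)) sums ?int (\<Union>i. A i)"
      proof -
        have "(\<lambda>i. indicator (A i) x * G x) sums (indicator (\<Union>i. A i) x * G x)" for x
        proof (cases "x \<in> (\<Union>i. A i)")
          case True
          then obtain j where j: "x \<in> A j" by auto
          then have "indicator (A i) x * G x = (if i = j then G x else 0)" for i
            using union(1) by (auto simp: disjoint_family_on_def indicator_def)
          then show ?thesis using sums_single[of j "\<lambda>_. G x"] True by simp
        qed (auto simp: indicator_def)
        note pt = this
        have "(\<lambda>N. \<integral>x. (\<Sum>i<N. indicator (A i) x * G x) \<partial>?M) \<longlonglongrightarrow> ?int (\<Union>i. A i)"
        proof (rule integral_dominated_convergence[where w = "\<lambda>x. \<bar>G x\<bar>"])
          show "AE x in ?M. (\<lambda>N. \<Sum>i<N. indicator (A i) x * G x) \<longlonglongrightarrow> indicator (\<Union>i. A i) x * G x"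
            using pt by (simp add: sums_def)
          show "AE x in ?M. norm (\<Sum>i<N. indicator (A i) x * G x) \<le> \<bar>G x\<bar>" for N
          proof (rule AE_I2)
            fix x
            have "disjoint_family_on A {..<N}"
              using union(1) by (auto simp: disjoint_family_on_def)
            then have "(\<Sum>i<N. indicator (A i) x) = (indicator (\<Union>i<N. A i) x :: real)"
              by (simp add: indicator_UN_disjoint)
            then show "norm (\<Sum>i<N. indicator (A i) x * G x) \<le> \<bar>G x\<bar>"
              by (simp add: sum_distrib_right[symmetric] indicator_def)
          qed
          show "(\<lambda>x. indicator (\<Union>i. A i) x * G x) \<in> borel_measurable ?M"
            using ind[of "\<Union>i. A i"] m by auto
          show "(\<lambda>x. \<Sum>i<N. indicator (A i) x * G x) \<in> borel_measurable ?M" for N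
            using ind m by (intro borel_measurable_sum) auto
        qed (use G in auto)
        then show ?thesis
          unfolding sums_def using ind m by (subst (asm) Bochner_Integration.integral_sum) auto
      qed
      then show ?case using union(3) by (simp add: sums_iff)
    qed
  qed
  show ?thesis
  proof (rule density_zero[OF G])
    fix A assume A: "A \<in> sets ?M"
    then have "A \<in> sets lebesgue" by (auto simp: sets_restrict_space)
    then obtain B N where BN: "B \<in> sets borel" "negligible N" "B \<union> N = A"
      using sets_lebesgue_almost_borel by blast
    have "AE x in lebesgue. x \<notin> N"
      using BN(2) by (simp add: negligible_iff_null_sets AE_not_in)
    then have N: "AE x in ?M. x \<notin> N" by (rule AE_mu_meas_lebesgue)
    have "set_lebesgue_integral ?M A G = ?int B"
      unfolding set_lebesgue_integral_def real_scaleR_def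
    proof (rule integral_cong_AE)
      show "AE x in ?M. indicat_real A x * G x = indicat_real B x * G x"
        using N by eventually_elim (use BN in \<open>auto simp: indicator_def\<close>)
      show "(\<lambda>x. indicat_real A x * G x) \<in> borel_measurable ?M"
        using G A by (intro borel_measurable_times borel_measurable_indicator) auto
    qed (use ind[OF BN(1)] in auto)
    then show "set_lebesgue_integral ?M A G = 0" using borel[OF BN(1)] by simp
  qed
qed

section \<open>The L2 contraction property\<close>

lemma gauss_sum_integrable:
  assumes "\<alpha> > -1/2" "\<And>i. i \<in> I \<Longrightarrow> s i > 0"
  shows "integrable (mu_meas \<alpha>) (\<lambda>x. \<Sum>i\<in>I. a i * gauss (s i) x)"
  using assms by (intro Bochner_Integration.integrable_sum integrable_mult_right integrable_gauss) auto

text \<open>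
  The product of the Gaussians with parameters s and t is the one with parameter s + t, whose integral is
  (s + t)^-(\<alpha>+1).
\<close>

lemma gauss_sum_sq_integral:
  assumes \<alpha>: "\<alpha> > -1/2" and s: "\<And>i. i \<in> I \<Longrightarrow> s i > 0"
  shows "integrable (mu_meas \<alpha>) (\<lambda>x. (\<Sum>i\<in>I. a i * gauss (s i) x)\<^sup>2)"
    and "(\<integral>x. (\<Sum>i\<in>I. a i * gauss (s i) x)\<^sup>2 \<partial>mu_meas \<alpha>)
           = (\<Sum>i\<in>I. \<Sum>j\<in>I. a i * a j * (s i + s j) powr - (\<alpha> + 1))"
proof -
  have eq: "(\<Sum>i\<in>I. a i * gauss (s i) x)\<^sup>2 = (\<Sum>i\<in>I. \<Sum>j\<in>I. a i * a j * gauss (s i + s j) x)" for x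
    unfolding power2_eq_square sum_product by (simp add: gauss_mult[symmetric] mult_ac)
  have ij: "integrable (mu_meas \<alpha>) (\<lambda>x. a i * a j * gauss (s i + s j) x)"
    if "i \<in> I" "j \<in> I" for i j
    using s[OF that(1)] s[OF that(2)] by (intro integrable_mult_right integrable_gauss \<alpha>) auto
  show "integrable (mu_meas \<alpha>) (\<lambda>x. (\<Sum>i\<in>I. a i * gauss (s i) x)\<^sup>2)"
    unfolding eq by (intro Bochner_Integration.integrable_sum ij)
  have ijv: "(\<integral>x. a i * a j * gauss (s i + s j) x \<partial>mu_meas \<alpha>) = a i * a j * (s i + s j) powr - (\<alpha> + 1)"
    if "i \<in> I" "j \<in> I" for i j
    using s[OF that(1)] s[OF that(2)] integral_gauss[OF \<alpha>, of "s i + s j"] by simp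
  have "(\<integral>x. (\<Sum>i\<in>I. a i * gauss (s i) x)\<^sup>2 \<partial>mu_meas \<alpha>)
      = (\<Sum>i\<in>I. \<integral>x. (\<Sum>j\<in>I. a i * a j * gauss (s i + s j) x) \<partial>mu_meas \<alpha>)"
    unfolding eq by (intro Bochner_Integration.integral_sum Bochner_Integration.integrable_sum ij)
  also have "\<dots> = (\<Sum>i\<in>I. \<Sum>j\<in>I. a i * a j * (s i + s j) powr - (\<alpha> + 1))"
    by (intro sum.cong refl, subst Bochner_Integration.integral_sum)
       (use ij ijv in \<open>auto intro!: sum.cong\<close>)
  finally show "(\<integral>x. (\<Sum>i\<in>I. a i * gauss (s i) x)\<^sup>2 \<partial>mu_meas \<alpha>)
           = (\<Sum>i\<in>I. \<Sum>j\<in>I. a i * a j * (s i + s j) powr - (\<alpha> + 1))" .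
qed

lemma hankel_gauss_sum:
  assumes \<alpha>: "\<alpha> > -1/2" and s: "\<And>i. i \<in> I \<Longrightarrow> s i > 0"
  shows "hankel \<alpha> (\<lambda>x. \<Sum>i\<in>I. a i * gauss (s i) x)
           = (\<lambda>y. \<Sum>i\<in>I. (a i * s i powr - (\<alpha> + 1)) * gauss (1 / s i) y)"
proof
  fix y
  let ?j = "\<lambda>x. bessel_j \<alpha> (2 * pi * x * y)"
  have int: "integrable (mu_meas \<alpha>) (\<lambda>x. a i * (gauss (s i) x * ?j x))" if "i \<in> I" for i
    using s[OF that] by (intro integrable_mult_right integrable_bessel_kernel integrable_gauss \<alpha>) auto
  have "hankel \<alpha> (\<lambda>x. \<Sum>i\<in>I. a i * gauss (s i) x) y
      = (\<integral>x. (\<Sum>i\<in>I. a i * (gauss (s i) x * ?j x)) \<partial>mu_meas \<alpha>)"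
    unfolding hankel_def by (simp add: sum_distrib_right mult.assoc)
  also have "\<dots> = (\<Sum>i\<in>I. a i * hankel \<alpha> (gauss (s i)) y)"
    using int by (subst Bochner_Integration.integral_sum) (auto simp: hankel_def)
  also have "\<dots> = (\<Sum>i\<in>I. (a i * s i powr - (\<alpha> + 1)) * gauss (1 / s i) y)"
    using s by (intro sum.cong refl) (simp add: hankel_gauss[OF \<alpha>])
  finally show "hankel \<alpha> (\<lambda>x. \<Sum>i\<in>I. a i * gauss (s i) x) y
      = (\<Sum>i\<in>I. (a i * s i powr - (\<alpha> + 1)) * gauss (1 / s i) y)" .
qed

text \<open>
  With the factors s^-(\<alpha>+1) and t^-(\<alpha>+1) coming from the transform, the inner product of two
  transformed Gaussians is (s t (1/s + 1/t))^-(\<alpha>+1) = (s + t)^-(\<alpha>+1), as before the transform.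
\<close>

lemma hankel_gauss_sum_isometry:
  fixes a s :: "'i \<Rightarrow> real"
  assumes \<alpha>: "\<alpha> > -1/2" and s: "\<And>i. i \<in> I \<Longrightarrow> s i > 0"
  defines "q \<equiv> \<lambda>x. \<Sum>i\<in>I. a i * gauss (s i) x"
  shows "integrable (mu_meas \<alpha>) (\<lambda>y. (hankel \<alpha> q y)\<^sup>2)"
    and "(\<integral>y. (hankel \<alpha> q y)\<^sup>2 \<partial>mu_meas \<alpha>) = (\<integral>x. (q x)\<^sup>2 \<partial>mu_meas \<alpha>)"
proof -
  have s': "1 / s i > 0" if "i \<in> I" for i using s[OF that] by simp
  have H: "hankel \<alpha> q = (\<lambda>y. \<Sum>i\<in>I. (a i * s i powr - (\<alpha> + 1)) * gauss (1 / s i) y)"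
    unfolding q_def by (rule hankel_gauss_sum[OF \<alpha> s])
  show "integrable (mu_meas \<alpha>) (\<lambda>y. (hankel \<alpha> q y)\<^sup>2)"
    unfolding H by (rule gauss_sum_sq_integral(1)[where s = "\<lambda>i. 1 / s i", OF \<alpha> s'])
  have "(a i * s i powr - (\<alpha> + 1)) * (a j * s j powr - (\<alpha> + 1)) * (1 / s i + 1 / s j) powr - (\<alpha> + 1)
      = a i * a j * (s i + s j) powr - (\<alpha> + 1)" if "i \<in> I" "j \<in> I" for i j
  proof -
    have "s i * s j * (1 / s i + 1 / s j) = s i + s j"
      using s[OF that(1)] s[OF that(2)] by (simp add: field_simps)
    moreover have "(s i * s j * (1 / s i + 1 / s j)) powr - (\<alpha> + 1)
        = s i powr - (\<alpha> + 1) * s j powr - (\<alpha> + 1) * (1 / s i + 1 / s j) powr - (\<alpha> + 1)"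
      using s[OF that(1)] s[OF that(2)] by (simp add: powr_mult)
    ultimately show ?thesis by simp
  qed
  note pair = this
  have "(\<integral>y. (hankel \<alpha> q y)\<^sup>2 \<partial>mu_meas \<alpha>) = (\<Sum>i\<in>I. \<Sum>j\<in>I.
      (a i * s i powr - (\<alpha> + 1)) * (a j * s j powr - (\<alpha> + 1)) * (1 / s i + 1 / s j) powr - (\<alpha> + 1))"
    unfolding H by (rule gauss_sum_sq_integral(2)[where s = "\<lambda>i. 1 / s i", OF \<alpha> s'])
  also have "\<dots> = (\<Sum>i\<in>I. \<Sum>j\<in>I. a i * a j * (s i + s j) powr - (\<alpha> + 1))"
    by (intro sum.cong refl pair)
  also have "\<dots> = (\<integral>x. (q x)\<^sup>2 \<partial>mu_meas \<alpha>)"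
    unfolding q_def by (rule gauss_sum_sq_integral(2)[OF \<alpha> s, symmetric])
  finally show "(\<integral>y. (hankel \<alpha> q y)\<^sup>2 \<partial>mu_meas \<alpha>) = (\<integral>x. (q x)\<^sup>2 \<partial>mu_meas \<alpha>)" .
qed

text \<open>
  This is 0 \<le> \<integral> (f - H q)^2 expanded, with \<integral> f (H q) = \<integral> (H f) q and \<integral> (H q)^2 = \<integral> q^2.
  In this form the transform of q has disappeared, so that q may be replaced by limits.
\<close>

lemma hankel_duality_bound:
  fixes a s :: "'i \<Rightarrow> real"
  assumes \<alpha>: "\<alpha> > -1/2" and s: "\<And>i. i \<in> I \<Longrightarrow> s i > 0"
    and f: "integrable (mu_meas \<alpha>) f" and f2: "integrable (mu_meas \<alpha>) (\<lambda>x. (f x)\<^sup>2)"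
  defines "q \<equiv> \<lambda>x. \<Sum>i\<in>I. a i * gauss (s i) x"
  shows "2 * (\<integral>x. hankel \<alpha> f x * q x \<partial>mu_meas \<alpha>) - (\<integral>x. (q x)\<^sup>2 \<partial>mu_meas \<alpha>)
           \<le> (\<integral>x. (f x)\<^sup>2 \<partial>mu_meas \<alpha>)"
proof -
  let ?M = "mu_meas \<alpha>" and ?H = "hankel \<alpha> q"
  have q: "integrable ?M q" unfolding q_def by (rule gauss_sum_integrable[OF \<alpha> s])
  have iso1: "integrable ?M (\<lambda>y. (?H y)\<^sup>2)"
    unfolding q_def by (rule hankel_gauss_sum_isometry(1)[OF \<alpha> s])
  have iso2: "(\<integral>y. (?H y)\<^sup>2 \<partial>?M) = (\<integral>x. (q x)\<^sup>2 \<partial>?M)"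
    unfolding q_def by (rule hankel_gauss_sum_isometry(2)[OF \<alpha> s])
  have fH: "integrable ?M (\<lambda>x. f x * ?H x)"
    by (rule integrable_mult_bounded[OF f borel_measurable_hankel[OF \<alpha> q] abs_hankel_le[OF \<alpha> q]])
  have "0 \<le> (\<integral>x. (f x - ?H x)\<^sup>2 \<partial>?M)"
    by (intro integral_nonneg_AE) auto
  also have "\<dots> = (\<integral>x. (f x)\<^sup>2 - 2 * (f x * ?H x) + (?H x)\<^sup>2 \<partial>?M)"
    by (simp add: power2_diff algebra_simps)
  also have "\<dots> = (\<integral>x. (f x)\<^sup>2 \<partial>?M) - 2 * (\<integral>x. f x * ?H x \<partial>?M) + (\<integral>x. (q x)\<^sup>2 \<partial>?M)"
    using f2 fH iso1 iso2 by simp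
  also have "(\<integral>x. f x * ?H x \<partial>?M) = (\<integral>x. hankel \<alpha> f x * q x \<partial>?M)"
    by (rule hankel_swap[OF \<alpha> f q])
  finally show ?thesis by simp
qed

text \<open>
  The error is measured relative to a Gaussian, which makes it small in L1 and in L2 at once: with
  v = exp(-\<pi> x^2) the function w / v is continuous in v on [0,1], being zero near v = 0, and a
  polynomial approximation of it is multiplied by v again.
\<close>

lemma gauss_sum_approximation:
  fixes w :: "real \<Rightarrow> real"
  assumes w: "continuous_on UNIV w" and R: "R > 0" and w0: "\<And>x. x \<ge> R \<Longrightarrow> w x = 0" and e: "e > 0"
  obtains a N where "\<And>x. x \<ge> 0 \<Longrightarrow> \<bar>w x - (\<Sum>i\<le>N. a i * gauss (real (Suc i)) x)\<bar> \<le> e * gauss 1 x"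
proof -
  define c where "c = gauss 1 R"
  have c: "c > 0" "c \<le> 1" by (simp_all add: c_def gauss_pos gauss_le_one)
  \<comment> \<open>The function w / v in the variable v.  Cutting v off at c, where w vanishes, extends it continuously to
    v = 0 without a case distinction.\<close>
  define \<Phi> where "\<Phi> v = w (sqrt (- ln (max v c) / pi)) / max v c" for v
  have mc: "max v c \<noteq> 0" for v using c by (simp add: max_def)
  have "continuous_on {0..1} (\<lambda>v. w (sqrt (- ln (max v c) / pi)))"
    by (rule continuous_on_compose2[OF w])
       (use mc in \<open>auto intro!: continuous_intros continuous_on_max\<close>)
  then have "continuous_on {0..1} \<Phi>"
    unfolding \<Phi>_def using mc by (intro continuous_intros continuous_on_max) auto
  from real_polynomial_approximation[OF _ this e]
  obtain a N where aN: "\<And>v. v \<in> {0..1} \<Longrightarrow> \<bar>\<Phi> v - (\<Sum>i\<le>N. a i * v ^ i)\<bar> < e"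
    by auto
  show ?thesis
  proof (rule that)
    fix x :: real assume x: "x \<ge> 0"
    define v where "v = gauss 1 x"
    have v: "v > 0" "v \<le> 1" by (simp_all add: v_def gauss_pos gauss_le_one)
    have lnv: "sqrt (- ln (gauss 1 t) / pi) = t" if "t \<ge> 0" for t
      using that by (simp add: gauss_def)
    have mono: "v \<ge> c \<longleftrightarrow> x \<le> R"
      using x R gauss_le_iff[of R x] by (simp add: v_def c_def)
    have eq: "w x = \<Phi> v * v"
    proof (cases "x \<le> R")
      case True
      then have "max v c = v" using mono by (simp add: max_def)
      then show ?thesis using v lnv[OF x] by (simp add: \<Phi>_def v_def)
    next
      case False
      then have "max v c = c" using mono by (simp add: max_def)
      moreover have "sqrt (- ln c / pi) = R" unfolding c_def using lnv[of R] R by simp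
      ultimately show ?thesis using False w0[of x] w0[of R] by (simp add: \<Phi>_def)
    qed
    have "(\<Sum>i\<le>N. a i * gauss (real (Suc i)) x) = (\<Sum>i\<le>N. a i * v ^ i) * v"
      unfolding sum_distrib_right
    proof (intro sum.cong refl)
      fix i
      show "a i * gauss (real (Suc i)) x = a i * v ^ i * v"
        using gauss_power[of 1 x "Suc i"] by (simp add: v_def mult_ac)
    qed
    then have "w x - (\<Sum>i\<le>N. a i * gauss (real (Suc i)) x) = (\<Phi> v - (\<Sum>i\<le>N. a i * v ^ i)) * v"
      unfolding eq by (simp add: algebra_simps)
    also have "\<bar>\<dots>\<bar> \<le> e * v"
      using aN[of v] v by (simp add: abs_mult less_imp_le)
    finally show "\<bar>w x - (\<Sum>i\<le>N. a i * gauss (real (Suc i)) x)\<bar> \<le> e * gauss 1 x"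
      by (simp add: v_def)
  qed
qed

lemma le_gauss_of_compact_support:
  fixes w :: "real \<Rightarrow> real"
  assumes w: "continuous_on UNIV w" and R: "R > 0" and w0: "\<And>x. x \<ge> R \<Longrightarrow> w x = 0"
  obtains K where "K \<ge> 0" "\<And>x. x \<ge> 0 \<Longrightarrow> \<bar>w x\<bar> \<le> K * gauss 1 x"
proof -
  have "bounded ((\<lambda>x. w x / gauss 1 x) ` {0..R})"
    by (intro compact_imp_bounded compact_continuous_image continuous_intros continuous_on_subset[OF w])
       (auto simp: gauss_def intro!: continuous_intros)
  then obtain K where K: "\<forall>y \<in> (\<lambda>x. w x / gauss 1 x) ` {0..R}. norm y \<le> K"
    unfolding bounded_iff by blast
  then have K': "\<bar>w x\<bar> / gauss 1 x \<le> K" if "0 \<le> x" "x \<le> R" for x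
    using that by (auto simp: abs_divide)
  have K0: "K \<ge> 0" using order_trans[OF _ K'[of 0]] R by (auto simp: gauss_def)
  show ?thesis
  proof (rule that[OF K0])
    fix x :: real assume "x \<ge> 0"
    then show "\<bar>w x\<bar> \<le> K * gauss 1 x"
      using K'[of x] w0[of x] gauss_pos[of 1 x] K0 by (cases "x \<le> R") (auto simp: field_simps)
  qed
qed

text \<open>
  The bound passes from Gaussian sums to continuous functions of bounded support by dominated
  convergence; a multiple of exp(-\<pi> x^2) dominates throughout.
\<close>

lemma hankel_duality_bound_limit:
  assumes \<alpha>: "\<alpha> > -1/2"
    and f: "integrable (mu_meas \<alpha>) f" and f2: "integrable (mu_meas \<alpha>) (\<lambda>x. (f x)\<^sup>2)"
    and w: "continuous_on UNIV w" and R: "R > 0" and w0: "\<And>x. x \<ge> R \<Longrightarrow> w x = 0"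
  shows "2 * (\<integral>x. hankel \<alpha> f x * w x \<partial>mu_meas \<alpha>) - (\<integral>x. (w x)\<^sup>2 \<partial>mu_meas \<alpha>)
           \<le> (\<integral>x. (f x)\<^sup>2 \<partial>mu_meas \<alpha>)"
proof -
  let ?M = "mu_meas \<alpha>"
  have "\<exists>a N. \<forall>x\<ge>0. \<bar>w x - (\<Sum>i\<le>N. a i * gauss (real (Suc i)) x)\<bar> \<le> inverse (real (Suc n)) * gauss 1 x" for n
  proof -
    obtain a N where
      "\<And>x. x \<ge> 0 \<Longrightarrow> \<bar>w x - (\<Sum>i\<le>N. a i * gauss (real (Suc i)) x)\<bar> \<le> inverse (real (Suc n)) * gauss 1 x"
      using gauss_sum_approximation[OF w R w0, of "inverse (real (Suc n))"] by auto
    then show ?thesis by blast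
  qed
  then obtain a :: "nat \<Rightarrow> nat \<Rightarrow> real" and N :: "nat \<Rightarrow> nat" where
    aN: "\<And>n x. x \<ge> 0 \<Longrightarrow>
      \<bar>w x - (\<Sum>i\<le>N n. a n i * gauss (real (Suc i)) x)\<bar> \<le> inverse (real (Suc n)) * gauss 1 x"
    by metis
  define q where "q n x = (\<Sum>i\<le>N n. a n i * gauss (real (Suc i)) x)" for n x
  obtain K where K: "K \<ge> 0" "\<And>x. x \<ge> 0 \<Longrightarrow> \<bar>w x\<bar> \<le> K * gauss 1 x"
    using le_gauss_of_compact_support[OF w R w0] by blast
  have close: "\<bar>w x - q n x\<bar> \<le> inverse (real (Suc n)) * gauss 1 x" if "x \<ge> 0" for n x
    using aN[OF that] by (simp add: q_def)
  have qle: "\<bar>q n x\<bar> \<le> (K + 1) * gauss 1 x" if "x \<ge> 0" for n x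
  proof -
    have "inverse (real (Suc n)) * gauss 1 x \<le> 1 * gauss 1 x"
      by (intro mult_right_mono) (auto simp: field_simps)
    then show ?thesis using close[OF that, of n] K(2)[OF that] by (simp add: distrib_right) 
  qed
  have lim: "(\<lambda>n. q n x) \<longlonglongrightarrow> w x" if "x \<ge> 0" for x
  proof -
    have "(\<lambda>n. inverse (real (Suc n)) * gauss 1 x) \<longlonglongrightarrow> 0"
      using tendsto_mult_left_zero[OF LIMSEQ_inverse_real_of_nat] .
    then have "(\<lambda>n. q n x - w x) \<longlonglongrightarrow> 0"
      by (rule Lim_null_comparison[rotated])
         (use close[OF that] in \<open>auto simp: abs_minus_commute\<close>)
    then show ?thesis by (simp add: LIM_zero_iff)
  qed
  have mw: "w \<in> borel_measurable ?M"
    by (intro measurable_mu_meas_borel borel_measurable_continuous_onI w)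
  have mq: "q n \<in> borel_measurable ?M" for n
    unfolding q_def using measurable_gauss_mu by (intro borel_measurable_sum borel_measurable_times) auto
  have mu: "hankel \<alpha> f \<in> borel_measurable ?M" by (rule borel_measurable_hankel[OF \<alpha> f])
  define C where "C = (\<integral>x. \<bar>f x\<bar> \<partial>?M)"
  have C: "\<bar>hankel \<alpha> f x\<bar> \<le> C" for x unfolding C_def by (rule abs_hankel_le[OF \<alpha> f])
  have ig: "integrable ?M (gauss 1)" by (rule integrable_gauss[OF \<alpha>]) simp
  have 1: "(\<lambda>n. \<integral>x. hankel \<alpha> f x * q n x \<partial>?M) \<longlonglongrightarrow> (\<integral>x. hankel \<alpha> f x * w x \<partial>?M)"
  proof (rule integral_dominated_convergence[where w = "\<lambda>x. C * ((K + 1) * gauss 1 x)"])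
    show "AE x in ?M. (\<lambda>n. hankel \<alpha> f x * q n x) \<longlonglongrightarrow> hankel \<alpha> f x * w x"
      by (intro AE_I2 tendsto_mult_left lim) auto
    show "AE x in ?M. norm (hankel \<alpha> f x * q n x) \<le> C * ((K + 1) * gauss 1 x)" for n
      using C qle order_trans[OF abs_ge_zero C] by (auto simp: abs_mult intro!: mult_mono)
  qed (use mu mq mw ig in auto)
  have 2: "(\<lambda>n. \<integral>x. (q n x)\<^sup>2 \<partial>?M) \<longlonglongrightarrow> (\<integral>x. (w x)\<^sup>2 \<partial>?M)"
  proof (rule integral_dominated_convergence[where w = "\<lambda>x. (K + 1)\<^sup>2 * gauss 1 x"])
    show "AE x in ?M. (\<lambda>n. (q n x)\<^sup>2) \<longlonglongrightarrow> (w x)\<^sup>2"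
      by (intro AE_I2 tendsto_power lim) auto
    show "AE x in ?M. norm ((q n x)\<^sup>2) \<le> (K + 1)\<^sup>2 * gauss 1 x" for n
    proof (rule AE_I2)
      fix x assume "x \<in> space ?M"
      then have "\<bar>q n x\<bar>\<^sup>2 \<le> ((K + 1) * gauss 1 x)\<^sup>2"
        by (intro power_mono qle) auto
      also have "\<dots> = (K + 1)\<^sup>2 * (gauss 1 x * gauss 1 x)"
        by (simp add: power_mult_distrib power2_eq_square)
      also have "\<dots> \<le> (K + 1)\<^sup>2 * (gauss 1 x * 1)"
        by (intro mult_left_mono gauss_le_one) auto
      finally show "norm ((q n x)\<^sup>2) \<le> (K + 1)\<^sup>2 * gauss 1 x" by simp
    qed
  qed (use mq mw ig in auto)
  have "2 * (\<integral>x. hankel \<alpha> f x * q n x \<partial>?M) - (\<integral>x. (q n x)\<^sup>2 \<partial>?M) \<le> (\<integral>x. (f x)\<^sup>2 \<partial>?M)" for n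
    unfolding q_def by (rule hankel_duality_bound[OF \<alpha> _ f f2]) simp
  then show ?thesis
    by (intro LIMSEQ_le_const2[OF tendsto_diff[OF tendsto_mult_left[OF 1] 2]]) auto
qed

text \<open>
  With u = H f and a continuous cut-off 0 \<le> \<kappa> \<le> 1, the duality bound for w = u \<kappa> reads
  2 \<integral> u^2 \<kappa> - \<integral> u^2 \<kappa>^2 \<le> \<integral> f^2; since \<kappa>^2 \<le> \<kappa>, the left side is at least \<integral> u^2 \<kappa>.  The cut-offs
  increase to 1, and Fatou's lemma removes them.
\<close>

lemma hankel_nn_integral_sq_le:
  assumes \<alpha>: "\<alpha> > -1/2" and f: "integrable (mu_meas \<alpha>) f"
  shows "(\<integral>\<^sup>+x. ennreal ((hankel \<alpha> f x)\<^sup>2) \<partial>mu_meas \<alpha>) \<le> (\<integral>\<^sup>+x. ennreal ((f x)\<^sup>2) \<partial>mu_meas \<alpha>)"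
proof (cases "(\<integral>\<^sup>+x. ennreal ((f x)\<^sup>2) \<partial>mu_meas \<alpha>) = \<infinity>")
  case False
  let ?M = "mu_meas \<alpha>" and ?u = "hankel \<alpha> f"
  have f2: "integrable ?M (\<lambda>x. (f x)\<^sup>2)"
    using f False by (intro integrableI_bounded) (auto simp: top.not_eq_extremum)
  define \<kappa> where "\<kappa> n x = max 0 (min 1 (real n + 1 - x))" for n :: nat and x :: real
  have \<kappa>: "0 \<le> \<kappa> n x" "\<kappa> n x \<le> 1" for n x by (auto simp: \<kappa>_def)
  have mu: "?u \<in> borel_measurable ?M" by (rule borel_measurable_hankel[OF \<alpha> f])
  have m\<kappa>: "\<kappa> n \<in> borel_measurable ?M" for n
    unfolding \<kappa>_def by (rule measurable_mu_meas_borel) measurable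
  have bound: "(\<integral>\<^sup>+x. ennreal ((?u x)\<^sup>2 * \<kappa> n x) \<partial>?M) \<le> (\<integral>\<^sup>+x. ennreal ((f x)\<^sup>2) \<partial>?M)" for n
  proof -
    define w where "w x = ?u x * \<kappa> n x" for x
    have w: "continuous_on UNIV w"
      unfolding w_def \<kappa>_def by (intro continuous_intros continuous_on_hankel[OF \<alpha> f])
    have R: "real n + 1 > 0" by simp
    have w0: "w x = 0" if "x \<ge> real n + 1" for x using that by (simp add: w_def \<kappa>_def)
    obtain K where K: "K \<ge> 0" "\<And>x. x \<ge> 0 \<Longrightarrow> \<bar>w x\<bar> \<le> K * gauss 1 x"
      using le_gauss_of_compact_support[OF w R w0] by blast
    have mw: "w \<in> borel_measurable ?M" unfolding w_def using mu m\<kappa> by (rule borel_measurable_times)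
    have ig: "integrable ?M (gauss 1)" by (rule integrable_gauss[OF \<alpha>]) simp
    have iw: "integrable ?M w"
      by (rule Bochner_Integration.integrable_bound[of _ "\<lambda>x. K * gauss 1 x"])
         (use ig mw K in \<open>auto simp: abs_mult\<close>)
    have "integrable ?M (\<lambda>x. w x * ?u x)"
      by (rule integrable_mult_bounded[OF iw mu abs_hankel_le[OF \<alpha> f]])
    then have iuw: "integrable ?M (\<lambda>x. ?u x * w x)" by (simp add: mult.commute)
    have pt: "(w x)\<^sup>2 \<le> ?u x * w x" for x
    proof -
      have "(w x)\<^sup>2 = (?u x)\<^sup>2 * \<kappa> n x * \<kappa> n x" by (simp add: w_def power2_eq_square)
      also have "\<dots> \<le> (?u x)\<^sup>2 * \<kappa> n x * 1" by (intro mult_left_mono mult_nonneg_nonneg \<kappa>) auto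
      finally show ?thesis by (simp add: w_def power2_eq_square mult_ac)
    qed
    have iww: "integrable ?M (\<lambda>x. (w x)\<^sup>2)"
      by (rule Bochner_Integration.integrable_bound[OF iuw])
         (use mw pt in \<open>auto intro: order_trans[OF _ abs_ge_self]\<close>)
    have "(\<integral>x. (w x)\<^sup>2 \<partial>?M) \<le> (\<integral>x. ?u x * w x \<partial>?M)"
      by (rule integral_mono[OF iww iuw pt])
    with hankel_duality_bound_limit[OF \<alpha> f f2 w R w0]
    have le: "(\<integral>x. ?u x * w x \<partial>?M) \<le> (\<integral>x. (f x)\<^sup>2 \<partial>?M)" by simp
    have "(\<integral>\<^sup>+x. ennreal ((?u x)\<^sup>2 * \<kappa> n x) \<partial>?M) = (\<integral>\<^sup>+x. ennreal (?u x * w x) \<partial>?M)"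
      by (simp add: w_def power2_eq_square mult_ac)
    also have "\<dots> = ennreal (\<integral>x. ?u x * w x \<partial>?M)"
      by (rule nn_integral_eq_integral[OF iuw]) (use pt order_trans[OF zero_le_power2] in auto)
    also have "\<dots> \<le> ennreal (\<integral>x. (f x)\<^sup>2 \<partial>?M)" using le by (rule ennreal_leI)
    also have "\<dots> = (\<integral>\<^sup>+x. ennreal ((f x)\<^sup>2) \<partial>?M)"
      by (rule nn_integral_eq_integral[OF f2, symmetric]) auto
    finally show ?thesis .
  qed
  have "(\<lambda>n. ennreal ((?u x)\<^sup>2 * \<kappa> n x)) \<longlonglongrightarrow> ennreal ((?u x)\<^sup>2)" for x
  proof (rule tendsto_eventually)
    obtain N :: nat where "x \<le> real N" using real_arch_simple by blast
    then have "\<kappa> n x = 1" if "n \<ge> N" for n using that by (simp add: \<kappa>_def)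
    then show "\<forall>\<^sub>F n in sequentially. ennreal ((?u x)\<^sup>2 * \<kappa> n x) = ennreal ((?u x)\<^sup>2)"
      by (intro eventually_sequentiallyI[of N]) simp
  qed
  then have "liminf (\<lambda>n. ennreal ((?u x)\<^sup>2 * \<kappa> n x)) = ennreal ((?u x)\<^sup>2)" for x
    by (intro lim_imp_Liminf) auto
  then have "(\<integral>\<^sup>+x. ennreal ((?u x)\<^sup>2) \<partial>?M) = (\<integral>\<^sup>+x. liminf (\<lambda>n. ennreal ((?u x)\<^sup>2 * \<kappa> n x)) \<partial>?M)"
    by simp
  also have "\<dots> \<le> liminf (\<lambda>n. \<integral>\<^sup>+x. ennreal ((?u x)\<^sup>2 * \<kappa> n x) \<partial>?M)"
    using mu m\<kappa> by (intro nn_integral_liminf) auto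
  also have "\<dots> \<le> (\<integral>\<^sup>+x. ennreal ((f x)\<^sup>2) \<partial>?M)"
    using bound by (intro Liminf_le) auto
  finally show ?thesis .
qed auto

section \<open>Inversion, and passage to complex functions\<close>

text \<open>
  Each Gaussian is a multiple of the transform of another one.  Moving the transform across the
  integral twice shows that f and H (H f) have the same integrals against all Gaussians.
\<close>

lemma hankel_inversion:
  assumes \<alpha>: "\<alpha> > -1/2" and f: "integrable (mu_meas \<alpha>) f"
    and Hf: "integrable (mu_meas \<alpha>) (hankel \<alpha> f)"
  shows "AE x in mu_meas \<alpha>. f x = hankel \<alpha> (hankel \<alpha> f) x"
proof -
  let ?M = "mu_meas \<alpha>" and ?h = "hankel \<alpha> (hankel \<alpha> f)"
  have hm: "?h \<in> borel_measurable ?M" by (rule borel_measurable_hankel[OF \<alpha> Hf])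
  have ifg: "integrable ?M (\<lambda>x. f x * gauss s x)" if "s > 0" for s
    by (rule integrable_mult_bounded[OF f measurable_gauss_mu, where B = 1])
       (use that in \<open>simp add: gauss_le_one\<close>)
  have ihg: "integrable ?M (\<lambda>x. ?h x * gauss s x)" if "s > 0" for s
    using integrable_mult_bounded[OF integrable_gauss[OF \<alpha> that] hm abs_hankel_le[OF \<alpha> Hf]]
    by (simp add: mult.commute)
  have same: "(\<integral>x. f x * gauss s x \<partial>?M) = (\<integral>x. ?h x * gauss s x \<partial>?M)" if s: "s > 0" for s
  proof -
    define c where "c = s powr - (\<alpha> + 1)"
    have s': "1 / s > 0" using s by simp
    have "gauss s x = c * hankel \<alpha> (gauss (1 / s)) x" for x
      using s by (simp add: hankel_gauss[OF \<alpha> s'] c_def powr_divide)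
    then have "(\<integral>x. f x * gauss s x \<partial>?M) = c * (\<integral>x. f x * hankel \<alpha> (gauss (1 / s)) x \<partial>?M)"
      by (simp add: mult_ac flip: integral_mult_right_zero)
    also have "\<dots> = c * (\<integral>x. hankel \<alpha> f x * gauss (1 / s) x \<partial>?M)"
      by (simp only: hankel_swap[OF \<alpha> f integrable_gauss[OF \<alpha> s']])
    also have "\<dots> = (\<integral>x. hankel \<alpha> f x * hankel \<alpha> (gauss s) x \<partial>?M)"
      unfolding hankel_gauss[OF \<alpha> s] c_def[symmetric]
      by (simp add: mult_ac flip: integral_mult_right_zero)
    also have "\<dots> = (\<integral>x. ?h x * gauss s x \<partial>?M)"
      by (rule hankel_swap[OF \<alpha> Hf integrable_gauss[OF \<alpha> s]])
    finally show ?thesis .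
  qed
  \<comment> \<open>H (H f) is only bounded; one Gaussian factor is spent on making the difference integrable.\<close>
  have "AE x in ?M. (f x - ?h x) * gauss 1 x = 0"
  proof (rule gaussian_moments_determine)
    show "integrable ?M (\<lambda>x. (f x - ?h x) * gauss 1 x)"
      using ifg[of 1] ihg[of 1] by (simp add: left_diff_distrib)
    fix n :: nat
    have "(\<integral>x. (f x - ?h x) * gauss 1 x * gauss (real n) x \<partial>?M)
        = (\<integral>x. f x * gauss (1 + real n) x - ?h x * gauss (1 + real n) x \<partial>?M)"
      by (intro Bochner_Integration.integral_cong refl)
         (simp add: gauss_mult[symmetric] algebra_simps)
    also have "\<dots> = 0"
      using ifg[of "1 + real n"] ihg[of "1 + real n"] same[of "1 + real n"] by simp
    finally show "(\<integral>x. (f x - ?h x) * gauss 1 x * gauss (real n) x \<partial>?M) = 0" .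
  qed
  then show ?thesis
    by eventually_elim (use gauss_pos[of 1] in \<open>auto simp: less_le\<close>)
qed

lemma integrable_bessel_kernel_complex:
  fixes f :: "real \<Rightarrow> complex"
  assumes "\<alpha> > -1/2" "integrable (mu_meas \<alpha>) f"
  shows "integrable (mu_meas \<alpha>) (\<lambda>x. f x * complex_of_real (bessel_j \<alpha> (2 * pi * x * y)))"
proof (rule Bochner_Integration.integrable_bound[OF assms(2)])
  show "(\<lambda>x. f x * complex_of_real (bessel_j \<alpha> (2 * pi * x * y))) \<in> borel_measurable (mu_meas \<alpha>)"
    using assms(2) measurable_bessel_kernel[OF assms(1)]
    by (intro borel_measurable_times borel_measurable_of_real) auto
  show "AE x in mu_meas \<alpha>. norm (f x * complex_of_real (bessel_j \<alpha> (2 * pi * x * y))) \<le> norm (f x)"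
    using abs_bessel_j_le_one[OF assms(1)] by (auto simp: norm_mult mult_left_le)
qed

lemma fourier_bessel_Re_Im:
  assumes "\<alpha> > -1/2" "integrable (mu_meas \<alpha>) f"
  shows "Re (fourier_bessel \<alpha> f y) = hankel \<alpha> (\<lambda>x. Re (f x)) y"
    and "Im (fourier_bessel \<alpha> f y) = hankel \<alpha> (\<lambda>x. Im (f x)) y"
  using integrable_bessel_kernel_complex[OF assms, of y]
  by (simp_all add: fourier_bessel_def hankel_def flip: integral_Re integral_Im)

lemma fourier_bessel_nn_integral_sq_le:
  assumes \<alpha>: "\<alpha> > -1/2" and f: "integrable (mu_meas \<alpha>) f"
  shows "(\<integral>\<^sup>+x. ennreal ((norm (fourier_bessel \<alpha> f x))\<^sup>2) \<partial>mu_meas \<alpha>)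
           \<le> (\<integral>\<^sup>+x. ennreal ((norm (f x))\<^sup>2) \<partial>mu_meas \<alpha>)"
proof -
  let ?M = "mu_meas \<alpha>"
  let ?R = "\<lambda>x. Re (f x)" and ?I = "\<lambda>x. Im (f x)"
  have int: "integrable ?M ?R" "integrable ?M ?I" using f by auto
  note m = borel_measurable_hankel[OF \<alpha> int(1)] borel_measurable_hankel[OF \<alpha> int(2)]
  have "(\<integral>\<^sup>+x. ennreal ((norm (fourier_bessel \<alpha> f x))\<^sup>2) \<partial>?M)
      = (\<integral>\<^sup>+x. ennreal ((hankel \<alpha> ?R x)\<^sup>2) + ennreal ((hankel \<alpha> ?I x)\<^sup>2) \<partial>?M)"
    by (simp add: cmod_power2 fourier_bessel_Re_Im[OF \<alpha> f])
  also have "\<dots> = (\<integral>\<^sup>+x. ennreal ((hankel \<alpha> ?R x)\<^sup>2) \<partial>?M) + (\<integral>\<^sup>+x. ennreal ((hankel \<alpha> ?I x)\<^sup>2) \<partial>?M)"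
    using m by (intro nn_integral_add) auto
  also have "\<dots> \<le> (\<integral>\<^sup>+x. ennreal ((?R x)\<^sup>2) \<partial>?M) + (\<integral>\<^sup>+x. ennreal ((?I x)\<^sup>2) \<partial>?M)"
    by (intro add_mono hankel_nn_integral_sq_le \<alpha> int)
  also have "\<dots> = (\<integral>\<^sup>+x. ennreal ((?R x)\<^sup>2) + ennreal ((?I x)\<^sup>2) \<partial>?M)"
    using f by (intro nn_integral_add[symmetric]) auto
  also have "\<dots> = (\<integral>\<^sup>+x. ennreal ((norm (f x))\<^sup>2) \<partial>?M)"
    by (simp add: cmod_power2)
  finally show ?thesis .
qed

lemma fourier_bessel_inversion:
  assumes \<alpha>: "\<alpha> > -1/2" and f: "integrable (mu_meas \<alpha>) f"
    and F: "integrable (mu_meas \<alpha>) (fourier_bessel \<alpha> f)"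
  shows "AE x in mu_meas \<alpha>. f x = fourier_bessel \<alpha> (fourier_bessel \<alpha> f) x"
proof -
  let ?M = "mu_meas \<alpha>"
  let ?R = "\<lambda>x. Re (f x)" and ?I = "\<lambda>x. Im (f x)"
  note RI = fourier_bessel_Re_Im[OF \<alpha> f]
  have "AE x in ?M. ?R x = hankel \<alpha> (hankel \<alpha> ?R) x"
    using f F integrable_Re[OF F] by (intro hankel_inversion[OF \<alpha>]) (auto simp: RI)
  moreover have "AE x in ?M. ?I x = hankel \<alpha> (hankel \<alpha> ?I) x"
    using f F integrable_Im[OF F] by (intro hankel_inversion[OF \<alpha>]) (auto simp: RI)
  ultimately show ?thesis
    by eventually_elim (simp add: complex_eq_iff fourier_bessel_Re_Im[OF \<alpha> F] RI)
qed

lemma continuous_on_fourier_bessel: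
  assumes \<alpha>: "\<alpha> > -1/2" and f: "integrable (mu_meas \<alpha>) f"
  shows "continuous_on UNIV (fourier_bessel \<alpha> f)"
proof -
  have "continuous_on UNIV (\<lambda>y. complex_of_real (hankel \<alpha> (\<lambda>x. Re (f x)) y)
      + \<i> * complex_of_real (hankel \<alpha> (\<lambda>x. Im (f x)) y))"
    using f by (intro continuous_intros continuous_on_hankel[OF \<alpha>]) auto
  also have "(\<lambda>y. complex_of_real (hankel \<alpha> (\<lambda>x. Re (f x)) y)
      + \<i> * complex_of_real (hankel \<alpha> (\<lambda>x. Im (f x)) y)) = fourier_bessel \<alpha> f"
    by (auto simp: complex_eq_iff fourier_bessel_Re_Im[OF \<alpha> f])
  finally show ?thesis .
qed

lemma norm_fourier_bessel_le:
  assumes "\<alpha> > -1/2" "integrable (mu_meas \<alpha>) f"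
  shows "norm (fourier_bessel \<alpha> f y) \<le> (\<integral>x. norm (f x) \<partial>mu_meas \<alpha>)"
proof -
  have "norm (fourier_bessel \<alpha> f y)
      \<le> (\<integral>x. norm (f x * complex_of_real (bessel_j \<alpha> (2 * pi * x * y))) \<partial>mu_meas \<alpha>)"
    unfolding fourier_bessel_def by (rule integral_norm_bound)
  also have "\<dots> \<le> (\<integral>x. norm (f x) \<partial>mu_meas \<alpha>)"
    using assms abs_bessel_j_le_one[OF assms(1)]
    by (intro integral_mono integrable_norm integrable_bessel_kernel_complex)
       (auto simp: norm_mult mult_left_le)
  finally show ?thesis .
qed

section \<open>Entire extension of the transform of a boundedly supported function\<close>

text \<open>
  Each application of D to the kernel brings out a factor y^2 and raises the order of the Bessel function by
  one; here the measure absorbs that factor and moves up to the same order.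
\<close>

lemma mu_meas_shift:
  assumes \<beta>: "\<beta> > -1/2"
  shows "mu_meas (\<beta> + 1) = density (mu_meas \<beta>) (\<lambda>x. ennreal (pi / (\<beta> + 1) * x\<^sup>2))"
proof -
  let ?L = "lebesgue_on {0..} :: real measure"
  have g: "Gamma (\<beta> + 1) > 0" using \<beta> by (intro Gamma_real_pos) auto
  have "Gamma (\<beta> + 1 + 1) = (\<beta> + 1) * Gamma (\<beta> + 1)"
    using \<beta> by (intro Gamma_plus1) (auto elim!: nonpos_Ints_cases)
  then have c: "mu_const (\<beta> + 1) = mu_const \<beta> * (pi / (\<beta> + 1))"
    using powr_add[of pi "\<beta> + 1" 1] by (simp add: mu_const_def mult_ac)
  have eq: "ennreal (mu_const (\<beta> + 1) * x powr (2 * (\<beta> + 1) + 1))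
      = ennreal (mu_const \<beta> * x powr (2 * \<beta> + 1)) * ennreal (pi / (\<beta> + 1) * x\<^sup>2)" if "x \<ge> 0" for x
  proof -
    have "x powr (2 * (\<beta> + 1) + 1) = x powr (2 * \<beta> + 1) * x\<^sup>2"
      using that powr_add[of x "2 * \<beta> + 1" 2] by (cases "x = 0") (auto simp: algebra_simps)
    then show ?thesis
      unfolding c using mu_const_pos[OF \<beta>] \<beta>
      by (subst ennreal_mult[symmetric]) (auto simp: mult_ac)
  qed
  have m: "(\<lambda>x. ennreal (mu_const \<gamma> * x powr (2 * \<gamma> + 1))) \<in> borel_measurable ?L" for \<gamma>
    by (intro measurable_compose[OF measurable_mu_weight]) auto
  have m2: "(\<lambda>x. ennreal (pi / (\<beta> + 1) * x\<^sup>2)) \<in> borel_measurable ?L"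
    by (rule measurable_lebesgue_on_borel) measurable
  have "density (mu_meas \<beta>) (\<lambda>x. ennreal (pi / (\<beta> + 1) * x\<^sup>2)) =
      density ?L (\<lambda>x. ennreal (mu_const \<beta> * x powr (2 * \<beta> + 1)) * ennreal (pi / (\<beta> + 1) * x\<^sup>2))"
    unfolding mu_meas_eq by (rule density_density_eq[OF m m2])
  also have "\<dots> = mu_meas (\<beta> + 1)"
    unfolding mu_meas_eq
    by (intro density_cong borel_measurable_times_ennreal m m2 AE_I2) (auto simp only: eq space_restrict_space)
  finally show ?thesis by simp
qed

text \<open>
  The properties of F = H f used below; they do not refer to the order, so that F can be
  transformed with respect to every order \<alpha> + k.
\<close>

definition bounded_carried_by :: "real \<Rightarrow> (real \<Rightarrow> complex) \<Rightarrow> bool" where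
  "bounded_carried_by b G \<longleftrightarrow> b > 0 \<and> G \<in> borel_measurable borel
     \<and> (\<exists>C\<ge>0. \<forall>y. norm (G y) \<le> C) \<and> (\<forall>y>b. G y = 0)"

text \<open>
  Domination by a Gaussian gives integrability for all orders at once, and the factor b^(2 n) is the
  growth of the moments that makes the extension entire.
\<close>

lemma bounded_carried_by_le:
  assumes "bounded_carried_by b G"
  obtains C where "C \<ge> 0" "\<And>y n. y \<ge> 0 \<Longrightarrow> norm (G y * of_real (y ^ (2 * n))) \<le> C * b ^ (2 * n) * gauss 1 y"
proof -
  from assms obtain C where C: "C \<ge> 0" "\<And>y. norm (G y) \<le> C" and b: "b > 0" "\<And>y. y > b \<Longrightarrow> G y = 0"
    by (auto simp: bounded_carried_by_def)
  show ?thesis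
  \<comment> \<open>On [0,b] the quotient gauss 1 y / gauss 1 b is at least 1.\<close>
  proof (rule that[of "C / gauss 1 b"])
    show "C / gauss 1 b \<ge> 0" using C by simp
    fix y :: real and n assume y: "y \<ge> 0"
    show "norm (G y * of_real (y ^ (2 * n))) \<le> C / gauss 1 b * b ^ (2 * n) * gauss 1 y"
    proof (cases "y \<le> b")
      case True
      have "gauss 1 b \<le> gauss 1 y" using gauss_le_iff[of b y] b y True by simp
      then have r: "1 \<le> gauss 1 y / gauss 1 b" using gauss_pos[of 1 b] by simp
      have "norm (G y * of_real (y ^ (2 * n))) \<le> C * b ^ (2 * n)"
        unfolding norm_mult norm_of_real using C y True by (intro mult_mono power_mono) (auto intro: power_mono)
      also have "\<dots> = C * b ^ (2 * n) * 1" by simp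
      also have "\<dots> \<le> C * b ^ (2 * n) * (gauss 1 y / gauss 1 b)"
        using C by (intro mult_left_mono r) auto
      finally show ?thesis by simp
    next
      case False
      then show ?thesis using b C by simp
    qed
  qed
qed

lemma bounded_carried_by_integrable:
  assumes \<beta>: "\<beta> > -1/2" and G: "bounded_carried_by b G"
  shows "integrable (mu_meas \<beta>) (\<lambda>y. G y * of_real (y ^ (2 * n)))"
proof -
  obtain C where C: "C \<ge> 0" "\<And>y n. y \<ge> 0 \<Longrightarrow> norm (G y * of_real (y ^ (2 * n))) \<le> C * b ^ (2 * n) * gauss 1 y"
    using bounded_carried_by_le[OF G] by blast
  have "(\<lambda>y. G y * of_real (y ^ (2 * n))) \<in> borel_measurable borel"
    using G unfolding bounded_carried_by_def by (intro borel_measurable_times) auto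
  then have m: "(\<lambda>y. G y * of_real (y ^ (2 * n))) \<in> borel_measurable (mu_meas \<beta>)"
    by (rule measurable_mu_meas_borel)
  show ?thesis
  proof (rule Bochner_Integration.integrable_bound[OF _ m])
    show "integrable (mu_meas \<beta>) (\<lambda>y. C * b ^ (2 * n) * gauss 1 y)"
      using integrable_gauss[OF \<beta>, of 1] by simp
    show "AE y in mu_meas \<beta>. norm (G y * of_real (y ^ (2 * n))) \<le> norm (C * b ^ (2 * n) * gauss 1 y)"
      unfolding real_norm_def by (intro AE_I2 order_trans[OF C(2) abs_ge_self]) simp
  qed
qed

definition even_moment :: "real \<Rightarrow> (real \<Rightarrow> complex) \<Rightarrow> nat \<Rightarrow> complex" where
  "even_moment \<beta> G n = (\<integral>y. G y * of_real (y ^ (2 * n)) \<partial>mu_meas \<beta>)"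

lemma even_moment_bound:
  assumes \<beta>: "\<beta> > -1/2" and G: "bounded_carried_by b G"
  obtains A where "\<And>n. (\<integral>y. norm (G y * of_real (y ^ (2 * n))) \<partial>mu_meas \<beta>) \<le> A * b ^ (2 * n)"
proof -
  obtain C where C: "C \<ge> 0" "\<And>y n. y \<ge> 0 \<Longrightarrow> norm (G y * of_real (y ^ (2 * n))) \<le> C * b ^ (2 * n) * gauss 1 y"
    using bounded_carried_by_le[OF G] by blast
  have ig: "integrable (mu_meas \<beta>) (gauss 1)" by (rule integrable_gauss[OF \<beta>]) simp
  have "(\<integral>y. norm (G y * of_real (y ^ (2 * n))) \<partial>mu_meas \<beta>)
      \<le> (C * integral\<^sup>L (mu_meas \<beta>) (gauss 1)) * b ^ (2 * n)" for n
  proof -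
    have "(\<integral>y. norm (G y * of_real (y ^ (2 * n))) \<partial>mu_meas \<beta>)
        \<le> (\<integral>y. C * b ^ (2 * n) * gauss 1 y \<partial>mu_meas \<beta>)"
      by (intro integral_mono integrable_norm bounded_carried_by_integrable[OF \<beta> G]
            integrable_mult_right ig C(2)) auto
    then show ?thesis by (simp add: mult_ac)
  qed
  then show ?thesis by (rule that)
qed

lemma even_moment_shift:
  assumes \<beta>: "\<beta> > -1/2" and G: "bounded_carried_by b G"
  shows "even_moment (\<beta> + 1) G n = of_real (pi / (\<beta> + 1)) * even_moment \<beta> G (Suc n)"
proof -
  have mG: "(\<lambda>y. G y * of_real (y ^ (2 * n))) \<in> borel_measurable (mu_meas \<beta>)"
    using bounded_carried_by_integrable[OF \<beta> G] by auto
  have m2: "(\<lambda>y. pi / (\<beta> + 1) * y\<^sup>2) \<in> borel_measurable (mu_meas \<beta>)"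
    by (rule measurable_mu_meas_borel) measurable
  have "even_moment (\<beta> + 1) G n
      = (\<integral>y. (pi / (\<beta> + 1) * y\<^sup>2) *\<^sub>R (G y * of_real (y ^ (2 * n))) \<partial>mu_meas \<beta>)"
    unfolding even_moment_def mu_meas_shift[OF \<beta>]
    by (rule integral_density[OF mG m2]) (use \<beta> in auto)
  also have "\<dots> = (\<integral>y. of_real (pi / (\<beta> + 1)) * (G y * of_real (y ^ (2 * Suc n))) \<partial>mu_meas \<beta>)"
    by (intro Bochner_Integration.integral_cong refl)
       (simp add: scaleR_conv_of_real power2_eq_square mult_ac)
  finally show ?thesis by (simp add: even_moment_def)
qed

text \<open>
  The transform of order \<beta> of G, as a power series in w = x^2.  Working with w instead of x makes D the
  ordinary derivative.
\<close>

definition hankel_coeff :: "real \<Rightarrow> (real \<Rightarrow> complex) \<Rightarrow> nat \<Rightarrow> complex" where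
  "hankel_coeff \<beta> G n = of_real (bessel_coeff \<beta> n * pi ^ (2 * n)) * even_moment \<beta> G n"

definition hankel_extension :: "real \<Rightarrow> (real \<Rightarrow> complex) \<Rightarrow> complex \<Rightarrow> complex" where
  "hankel_extension \<beta> G w = (\<Sum>n. hankel_coeff \<beta> G n * w ^ n)"

lemma summable_moment_majorant:
  assumes \<beta>: "\<beta> > -1/2"
    and A: "\<And>n. 0 \<le> M n" "\<And>n. M n \<le> A * b ^ (2 * n)" and r: "r \<ge> 0"
  shows "summable (\<lambda>n. \<bar>bessel_coeff \<beta> n\<bar> * pi ^ (2 * n) * M n * r ^ n)"
proof (rule summable_comparison_test')
  show "summable (\<lambda>n. A * \<bar>bessel_coeff \<beta> n * (pi\<^sup>2 * b\<^sup>2 * r) ^ n\<bar>)"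
    by (intro summable_mult summable_abs_bessel[OF \<beta>])
  fix n
  have "\<bar>bessel_coeff \<beta> n\<bar> * pi ^ (2 * n) * M n * r ^ n
      \<le> \<bar>bessel_coeff \<beta> n\<bar> * pi ^ (2 * n) * (A * b ^ (2 * n)) * r ^ n"
    using r by (intro mult_right_mono mult_left_mono A) auto
  also have "\<dots> = A * \<bar>bessel_coeff \<beta> n * (pi\<^sup>2 * b\<^sup>2 * r) ^ n\<bar>"
    using r by (simp add: abs_mult power_mult power_mult_distrib)
  finally show "norm (\<bar>bessel_coeff \<beta> n\<bar> * pi ^ (2 * n) * M n * r ^ n)
      \<le> A * \<bar>bessel_coeff \<beta> n * (pi\<^sup>2 * b\<^sup>2 * r) ^ n\<bar>"
    using r A(1)[of n] by simp
qed

lemma summable_hankel_coeff: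
  assumes \<beta>: "\<beta> > -1/2" and G: "bounded_carried_by b G"
  shows "summable (\<lambda>n. hankel_coeff \<beta> G n * w ^ n)"
proof -
  obtain A where A: "\<And>n. (\<integral>y. norm (G y * of_real (y ^ (2 * n))) \<partial>mu_meas \<beta>) \<le> A * b ^ (2 * n)"
    using even_moment_bound[OF \<beta> G] by blast
  have "norm (even_moment \<beta> G n) \<le> A * b ^ (2 * n)" for n
    unfolding even_moment_def by (rule order_trans[OF integral_norm_bound A])
  from summable_moment_majorant[OF \<beta> _ this, of "norm w"]
  have "summable (\<lambda>n. norm (hankel_coeff \<beta> G n * w ^ n))"
    by (simp add: hankel_coeff_def norm_mult norm_power abs_mult)
  then show ?thesis by (rule summable_norm_cancel)
qed

text \<open>
  With J_\<beta> for bessel_series: (n + 1) times the coefficient n + 1 of J_\<beta> is -1/(\<beta> + 1) times the coefficient n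
  of J_(\<beta>+1), and the moment of index n + 1 for order \<beta> is (\<beta> + 1)/\<pi> times the moment of index n
  for order \<beta> + 1.
\<close>

lemma hankel_extension_deriv:
  assumes \<beta>: "\<beta> > -1/2" and G: "bounded_carried_by b G"
  shows "(hankel_extension \<beta> G has_field_derivative - of_real pi * hankel_extension (\<beta> + 1) G w) (at w)"
proof -
  have \<beta>1: "\<beta> + 1 > -1/2" using \<beta> by simp
  have "diffs (hankel_coeff \<beta> G) n = - of_real pi * hankel_coeff (\<beta> + 1) G n" for n
  proof -
    have p: "pochhammer (\<beta> + 1) (Suc n) = (\<beta> + 1) * pochhammer (\<beta> + 1 + 1) n"
      by (rule pochhammer_rec)
    have pz: "pochhammer (\<beta> + 1 + 1) n > 0" using pochhammer_ge_half[OF \<beta>1, of n] by linarith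
    have "real (Suc n) * bessel_coeff \<beta> (Suc n) = - bessel_coeff (\<beta> + 1) n / (\<beta> + 1)"
      using pz \<beta> unfolding bessel_coeff_def p by (simp add: divide_simps)
    then have "real (Suc n) * bessel_coeff \<beta> (Suc n) * pi ^ (2 * Suc n)
        = - pi * (bessel_coeff (\<beta> + 1) n * pi ^ (2 * n)) * (pi / (\<beta> + 1))"
      by (simp add: mult_ac)
    note step = this
    have "diffs (hankel_coeff \<beta> G) n
        = complex_of_real (real (Suc n) * bessel_coeff \<beta> (Suc n) * pi ^ (2 * Suc n)) * even_moment \<beta> G (Suc n)"
      unfolding diffs_def hankel_coeff_def by (simp only: of_real_mult of_real_of_nat_eq mult.assoc)
    also have "\<dots> = - of_real pi * hankel_coeff (\<beta> + 1) G n"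
      unfolding step hankel_coeff_def even_moment_shift[OF \<beta> G] by simp
    finally show ?thesis .
  qed
  then have "(\<Sum>n. diffs (hankel_coeff \<beta> G) n * w ^ n) = - of_real pi * hankel_extension (\<beta> + 1) G w"
    unfolding hankel_extension_def
    using suminf_mult[OF summable_hankel_coeff[OF \<beta>1 G, of w], of "- of_real pi"] by (simp add: mult_ac)
  then show ?thesis
    using termdiffs_strong_converges_everywhere[OF summable_hankel_coeff[OF \<beta> G], of w]
    by (simp add: hankel_extension_def[abs_def])
qed

text \<open>
  Term-by-term integration of the series of the kernel; the exchange is justified by the growth bound
  on the moments of |G|.
\<close>

lemma hankel_extension_eq_fourier_bessel:
  assumes \<beta>: "\<beta> > -1/2" and G: "bounded_carried_by b G"
  shows "hankel_extension \<beta> G ((complex_of_real x)\<^sup>2) = fourier_bessel \<beta> G x"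
proof -
  let ?M = "mu_meas \<beta>"
  define a where "a n = bessel_coeff \<beta> n * pi ^ (2 * n) * (x\<^sup>2) ^ n" for n
  define t where "t n y = of_real (a n) * (G y * of_real (y ^ (2 * n)))" for n and y :: real
  have t: "t n y = G y * of_real (bessel_coeff \<beta> n * ((2 * pi * y * x)\<^sup>2 / 4) ^ n)" for n y
  proof -
    have "(2 * pi * y * x)\<^sup>2 / 4 = pi\<^sup>2 * y\<^sup>2 * x\<^sup>2"
      by (simp add: power_mult_distrib)
    then have "((2 * pi * y * x)\<^sup>2 / 4) ^ n = pi ^ (2 * n) * y ^ (2 * n) * (x\<^sup>2) ^ n"
      by (simp only: power_mult_distrib power_mult)
    then show ?thesis by (simp add: t_def a_def)
  qed
  obtain A where A: "\<And>n. (\<integral>y. norm (G y * of_real (y ^ (2 * n))) \<partial>?M) \<le> A * b ^ (2 * n)"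
    using even_moment_bound[OF \<beta> G] by blast
  have int: "integrable ?M (t n)" for n
    unfolding t_def by (intro integrable_mult_right bounded_carried_by_integrable[OF \<beta> G])
  have "(\<lambda>n. integral\<^sup>L ?M (t n)) sums (\<integral>y. (\<Sum>n. t n y) \<partial>?M)"
  proof (rule sums_integral[OF int])
    show "AE y in ?M. summable (\<lambda>n. norm (t n y))"
    proof (rule AE_I2)
      fix y
      show "summable (\<lambda>n. norm (t n y))"
        unfolding t norm_mult norm_of_real
        by (intro summable_mult summable_abs_bessel[OF \<beta>])
    qed
    have "(\<integral>y. norm (t n y) \<partial>?M)
        = \<bar>bessel_coeff \<beta> n\<bar> * pi ^ (2 * n) * (\<integral>y. norm (G y * of_real (y ^ (2 * n))) \<partial>?M) * (x\<^sup>2) ^ n" for n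
    proof -
      have "(\<integral>y. norm (t n y) \<partial>?M)
          = norm (complex_of_real (a n)) * (\<integral>y. norm (G y * of_real (y ^ (2 * n))) \<partial>?M)"
        unfolding t_def norm_mult[of "complex_of_real (a n)"] by (rule integral_mult_right_zero)
      moreover have "norm (complex_of_real (a n)) = \<bar>bessel_coeff \<beta> n\<bar> * pi ^ (2 * n) * (x\<^sup>2) ^ n"
        unfolding norm_of_real by (simp add: a_def abs_mult)
      ultimately show ?thesis by (simp only: mult_ac)
    qed
    then show "summable (\<lambda>n. \<integral>y. norm (t n y) \<partial>?M)"
      using summable_moment_majorant[OF \<beta> _ A, of "x\<^sup>2"] by (simp only:) simp
  qed
  moreover have "integral\<^sup>L ?M (t n) = hankel_coeff \<beta> G n * ((complex_of_real x)\<^sup>2) ^ n" for n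
  proof -
    have "integral\<^sup>L ?M (t n) = of_real (a n) * even_moment \<beta> G n"
      unfolding t_def even_moment_def by (rule integral_mult_right_zero)
    then show ?thesis by (simp add: a_def hankel_coeff_def)
  qed
  moreover have "(\<Sum>n. t n y) = G y * of_real (bessel_j \<beta> (2 * pi * y * x))" for y
  proof -
    have s: "(\<lambda>n. bessel_coeff \<beta> n * ((2 * pi * y * x)\<^sup>2 / 4) ^ n) sums bessel_j \<beta> (2 * pi * y * x)"
      unfolding bessel_j_eq_series[OF \<beta>] bessel_series_def
      by (intro summable_sums summable_bessel[OF \<beta>])
    from sums_mult[OF sums_of_real[OF this], of "G y"] show ?thesis
      unfolding t by (simp add: sums_iff)
  qed
  ultimately show ?thesis
    by (simp add: hankel_extension_def fourier_bessel_def sums_iff)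
qed

section \<open>The operator D and the weighted norms\<close>

text \<open>
  For f(z) = p(z^2) one has f'(z) = 2 z p'(z^2).  At the origin D is defined through the second
  derivative, and f''(0) = 2 p'(0).
\<close>

lemma D_op_comp_square:
  assumes p: "\<And>w. (p has_field_derivative p' w) (at w)"
    and p': "\<And>w. (p' has_field_derivative p'' w) (at w)"
  shows "D_op (\<lambda>z. p (z\<^sup>2)) = (\<lambda>z. p' (z\<^sup>2))"
proof
  fix z :: complex
  have d: "((\<lambda>z. p (z\<^sup>2)) has_field_derivative p' (z\<^sup>2) * (2 * z)) (at z)" for z
    by (rule DERIV_chain2[OF p]) (auto intro!: derivative_eq_intros)
  have dd: "((\<lambda>z. p' (z\<^sup>2) * (2 * z)) has_field_derivative p'' (z\<^sup>2) * (2 * z) * (2 * z) + p' (z\<^sup>2) * 2) (at z)" for z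
  proof -
    have "((\<lambda>z. p' (z\<^sup>2)) has_field_derivative p'' (z\<^sup>2) * (2 * z)) (at z)"
      by (rule DERIV_chain2[OF p']) (auto intro!: derivative_eq_intros)
    then show ?thesis by (auto intro!: derivative_eq_intros)
  qed
  have d1: "deriv (\<lambda>z. p (z\<^sup>2)) = (\<lambda>z. p' (z\<^sup>2) * (2 * z))"
    by (rule ext) (rule DERIV_imp_deriv[OF d])
  have "(deriv ^^ 2) h = deriv (deriv h)" for h :: "complex \<Rightarrow> complex"
    by (simp add: numeral_2_eq_2)
  then have d2: "(deriv ^^ 2) (\<lambda>z. p (z\<^sup>2)) 0 = p' 0 * 2"
    using DERIV_imp_deriv[OF dd[of 0]] by (simp add: d1)
  show "D_op (\<lambda>z. p (z\<^sup>2)) z = p' (z\<^sup>2)"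
    by (simp add: D_op_def d1 d2)
qed

lemma D_op_power_hankel_extension:
  assumes \<beta>: "\<beta> > -1/2" and G: "bounded_carried_by b G"
  shows "(D_op ^^ k) (\<lambda>z. hankel_extension \<beta> G (z\<^sup>2))
           = (\<lambda>z. (- of_real pi) ^ k * hankel_extension (\<beta> + real k) G (z\<^sup>2))"
proof (induction k)
  case (Suc k)
  define h where "h j w = (- of_real pi) ^ j * hankel_extension (\<beta> + real j) G w" for j w
  have h: "(h j has_field_derivative h (Suc j) w) (at w)" for j w
  proof -
    have "\<beta> + real j > -1/2" using \<beta> by linarith
    from DERIV_cmult[OF hankel_extension_deriv[OF this G, of w], of "(- of_real pi) ^ j"]
    show ?thesis by (simp add: h_def[abs_def] mult_ac add_ac)
  qed
  have "D_op (\<lambda>z. h k (z\<^sup>2)) = (\<lambda>z. h (Suc k) (z\<^sup>2))"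
    by (rule D_op_comp_square[OF h h])
  then show ?case using Suc.IH by (simp add: h_def)
qed simp

text \<open>
  The weight \<pi> y^2 / (\<beta> + 1) between the two measures is at most \<pi> b^2 / (\<beta> + 1) where G is nonzero.
\<close>

lemma nn_integral_sq_shift_le:
  assumes \<beta>: "\<beta> > -1/2" and G: "bounded_carried_by b G"
  shows "(\<integral>\<^sup>+y. ennreal ((norm (G y))\<^sup>2) \<partial>mu_meas (\<beta> + 1))
           \<le> ennreal (pi * b\<^sup>2 / (\<beta> + 1)) * (\<integral>\<^sup>+y. ennreal ((norm (G y))\<^sup>2) \<partial>mu_meas \<beta>)"
proof -
  have mG: "(\<lambda>y. ennreal ((norm (G y))\<^sup>2)) \<in> borel_measurable (mu_meas \<beta>)"
  proof -
    have [measurable]: "G \<in> borel_measurable borel" using G by (simp add: bounded_carried_by_def)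
    show ?thesis by (rule measurable_mu_meas_borel) measurable
  qed
  have m2: "(\<lambda>y. ennreal (pi / (\<beta> + 1) * y\<^sup>2)) \<in> borel_measurable (mu_meas \<beta>)"
    by (rule measurable_mu_meas_borel) measurable
  have "(\<integral>\<^sup>+y. ennreal ((norm (G y))\<^sup>2) \<partial>mu_meas (\<beta> + 1))
      = (\<integral>\<^sup>+y. ennreal (pi / (\<beta> + 1) * y\<^sup>2) * ennreal ((norm (G y))\<^sup>2) \<partial>mu_meas \<beta>)"
    unfolding mu_meas_shift[OF \<beta>] by (rule nn_integral_density[OF m2 mG])
  also have "\<dots> \<le> (\<integral>\<^sup>+y. ennreal (pi * b\<^sup>2 / (\<beta> + 1)) * ennreal ((norm (G y))\<^sup>2) \<partial>mu_meas \<beta>)"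
  proof (rule nn_integral_mono)
    fix y assume "y \<in> space (mu_meas \<beta>)"
    then have y: "y \<ge> 0" by simp
    show "ennreal (pi / (\<beta> + 1) * y\<^sup>2) * ennreal ((norm (G y))\<^sup>2)
        \<le> ennreal (pi * b\<^sup>2 / (\<beta> + 1)) * ennreal ((norm (G y))\<^sup>2)"
    proof (cases "y \<le> b")
      case True
      have "pi / (\<beta> + 1) * y\<^sup>2 \<le> pi / (\<beta> + 1) * b\<^sup>2"
        using y True \<beta> by (intro mult_left_mono power_mono) auto
      then show ?thesis by (intro mult_right_mono ennreal_leI) auto
    next
      case False
      then show ?thesis using G by (simp add: bounded_carried_by_def)
    qed
  qed
  also have "\<dots> = ennreal (pi * b\<^sup>2 / (\<beta> + 1)) * (\<integral>\<^sup>+y. ennreal ((norm (G y))\<^sup>2) \<partial>mu_meas \<beta>)"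
    by (rule nn_integral_cmult[OF mG])
  finally show ?thesis .
qed

lemma nn_integral_sq_shift_power_le:
  assumes \<alpha>: "\<alpha> > -1/2" and G: "bounded_carried_by b G"
  shows "(\<integral>\<^sup>+y. ennreal ((norm (G y))\<^sup>2) \<partial>mu_meas (\<alpha> + real k))
           \<le> ennreal (Gamma (\<alpha> + 1) / Gamma (\<alpha> + real k + 1) * (pi * b\<^sup>2) ^ k)
               * (\<integral>\<^sup>+y. ennreal ((norm (G y))\<^sup>2) \<partial>mu_meas \<alpha>)"
proof (induction k)
  case 0
  have "Gamma (\<alpha> + 1) > 0" using \<alpha> by (intro Gamma_real_pos) auto
  then show ?case by simp
next
  case (Suc k)
  let ?I = "\<lambda>\<beta>. \<integral>\<^sup>+y. ennreal ((norm (G y))\<^sup>2) \<partial>mu_meas \<beta>"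
  let ?\<beta> = "\<alpha> + real k"
  define r where "r = Gamma (\<alpha> + 1) / Gamma (\<alpha> + real k + 1) * (pi * b\<^sup>2) ^ k"
  have \<beta>: "?\<beta> > -1/2" using \<alpha> by linarith
  have g: "Gamma (\<alpha> + 1) > 0" "Gamma (?\<beta> + 1) > 0" using \<alpha> by (auto intro!: Gamma_real_pos)
  have r: "r \<ge> 0" unfolding r_def using g by (intro mult_nonneg_nonneg divide_nonneg_pos) auto
  have "Gamma (?\<beta> + 1 + 1) = (?\<beta> + 1) * Gamma (?\<beta> + 1)"
    using \<beta> by (intro Gamma_plus1) (auto elim!: nonpos_Ints_cases)
  then have c: "pi * b\<^sup>2 / (?\<beta> + 1) * r
      = Gamma (\<alpha> + 1) / Gamma (\<alpha> + real (Suc k) + 1) * (pi * b\<^sup>2) ^ Suc k"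
    unfolding r_def by (simp add: add_ac mult_ac)
  have "?I (\<alpha> + real (Suc k)) = ?I (?\<beta> + 1)" by (simp add: add_ac)
  also have "\<dots> \<le> ennreal (pi * b\<^sup>2 / (?\<beta> + 1)) * ?I ?\<beta>"
    by (rule nn_integral_sq_shift_le[OF \<beta> G])
  also have "\<dots> \<le> ennreal (pi * b\<^sup>2 / (?\<beta> + 1)) * (ennreal r * ?I \<alpha>)"
    using Suc.IH unfolding r_def by (rule mult_left_mono) simp
  also have "\<dots> = ennreal (pi * b\<^sup>2 / (?\<beta> + 1) * r) * ?I \<alpha>"
    using \<beta> r by (subst ennreal_mult) (auto simp: mult.assoc)
  finally show ?case unfolding c .
qed

text \<open>
  Bounds between squared norms transfer to Lp_norm; a right-hand side with infinite norm is infinite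
  because K is positive.
\<close>

lemma Lp_norm_two_le:
  assumes K: "K > 0"
    and le: "(\<integral>\<^sup>+x. ennreal ((norm (h x))\<^sup>2) \<partial>mu_meas \<beta>)
               \<le> ennreal (K\<^sup>2) * (\<integral>\<^sup>+x. ennreal ((norm (f x))\<^sup>2) \<partial>mu_meas \<alpha>)"
  shows "Lp_norm 2 \<beta> h \<le> ennreal K * Lp_norm 2 \<alpha> f"
proof -
  define I where "I = (\<integral>\<^sup>+x. ennreal ((norm (f x))\<^sup>2) \<partial>mu_meas \<alpha>)"
  define J where "J = (\<integral>\<^sup>+x. ennreal ((norm (h x))\<^sup>2) \<partial>mu_meas \<beta>)"
  have L: "Lp_norm 2 \<alpha> f = (if I = \<infinity> then \<infinity> else ennreal (sqrt (enn2real I)))"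
    "Lp_norm 2 \<beta> h = (if J = \<infinity> then \<infinity> else ennreal (sqrt (enn2real J)))"
    by (simp_all add: Lp_norm_def I_def J_def powr_half_sqrt Let_def)
  show ?thesis
  proof (cases "I = \<infinity>")
    case True
    then show ?thesis using K by (simp add: L ennreal_mult_top)
  next
    case False
    then have "ennreal (K\<^sup>2) * I < \<infinity>" by (simp add: ennreal_mult_less_top top.not_eq_extremum)
    then have "J < \<infinity>" using le unfolding I_def J_def by (rule order_le_less_trans[rotated])
    then have J: "J \<noteq> \<infinity>" by auto
    have "enn2real J \<le> enn2real (ennreal (K\<^sup>2) * I)"
      using le \<open>ennreal (K\<^sup>2) * I < \<infinity>\<close> unfolding I_def J_def by (intro enn2real_mono) auto
    also have "\<dots> = K\<^sup>2 * enn2real I" by (simp add: enn2real_mult)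
    finally have "sqrt (enn2real J) \<le> sqrt (K\<^sup>2 * enn2real I)" by simp
    also have "\<dots> = K * sqrt (enn2real I)" using K by (simp add: real_sqrt_mult)
    finally have "ennreal (sqrt (enn2real J)) \<le> ennreal K * ennreal (sqrt (enn2real I))"
      using K by (subst ennreal_mult[symmetric]) (auto intro: ennreal_leI)
    then show ?thesis using False J by (simp add: L)
  qed
qed

theorem proposition2p1:
  fixes \<alpha> b :: real and f :: "real \<Rightarrow> complex"
  assumes "\<alpha> > - 1 / 2"
    and "b > 0"
    and "f \<in> Lp_space 1 \<alpha>"
    and "supp (fourier_bessel \<alpha> f) \<subseteq> {0..b}"
  shows "\<exists>g. even_entire g
           \<and> (AE x in mu_meas \<alpha>. f x = g (complex_of_real x))
           \<and> (\<forall>k::nat. Lp_norm 2 (\<alpha> + real k) (\<lambda>x. (D_op ^^ k) g (complex_of_real x))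
                \<le> ennreal (sqrt (Gamma (\<alpha> + 1) / Gamma (\<alpha> + real k + 1)) * (sqrt (pi ^ 3) * b) ^ k)
                   * Lp_norm 2 \<alpha> f)"
proof -
  have \<alpha>: "\<alpha> > -1/2" using assms(1) by simp
  have f: "integrable (mu_meas \<alpha>) f"
  proof (rule integrableI_bounded)
    show "f \<in> borel_measurable (mu_meas \<alpha>)" using assms(3) by (simp add: Lp_space_def)
    show "(\<integral>\<^sup>+x. ennreal (norm (f x)) \<partial>mu_meas \<alpha>) < \<infinity>"
      using assms(3) by (auto simp: Lp_space_def Lp_norm_def Let_def top.not_eq_extremum split: if_splits)
  qed
  define F where "F = fourier_bessel \<alpha> f"
  have "F y = 0" if "y > b" for y
  proof (rule ccontr)
    assume "F y \<noteq> 0"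
    then have "y \<in> support_on {0..} F" using that assms(2) by (simp add: support_on_def)
    then have "y \<in> supp F" unfolding supp_def using closure_subset by blast
    then show False using assms(4) that by (auto simp: F_def)
  qed
  moreover have "\<exists>C\<ge>0. \<forall>y. norm (F y) \<le> C"
    unfolding F_def using norm_fourier_bessel_le[OF \<alpha> f] order_trans[OF norm_ge_zero]
    by (intro exI[of _ "\<integral>x. norm (f x) \<partial>mu_meas \<alpha>"]) auto
  moreover have "F \<in> borel_measurable borel"
    unfolding F_def by (intro borel_measurable_continuous_onI continuous_on_fourier_bessel[OF \<alpha> f])
  ultimately have F: "bounded_carried_by b F"
    using assms(2) by (auto simp: bounded_carried_by_def)
  have iF: "integrable (mu_meas \<beta>) F" if "\<beta> > -1/2" for \<beta>
    using bounded_carried_by_integrable[OF that F, of 0] by simp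
  define g where "g z = hankel_extension \<alpha> F (z\<^sup>2)" for z
  \<comment> \<open>The identity D^k f = (-\<pi>)^k H_(\<alpha>+k) F; for k = 0 it identifies g with H_\<alpha> F on the half-line.\<close>
  have D: "(D_op ^^ k) g (complex_of_real x) = (- of_real pi) ^ k * fourier_bessel (\<alpha> + real k) F x" for k x
  proof -
    have \<beta>: "\<alpha> + real k > -1/2" using \<alpha> by linarith
    show ?thesis
      unfolding g_def D_op_power_hankel_extension[OF \<alpha> F] hankel_extension_eq_fourier_bessel[OF \<beta> F] ..
  qed
  have "(g has_field_derivative - of_real pi * hankel_extension (\<alpha> + 1) F (z\<^sup>2) * (2 * z)) (at z)" for z
    unfolding g_def
    by (rule DERIV_chain2[OF hankel_extension_deriv[OF \<alpha> F]]) (auto intro!: derivative_eq_intros)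
  then have "g holomorphic_on UNIV"
    by (auto simp: holomorphic_on_open)
  then have "even_entire g" by (simp add: even_entire_def g_def)
  moreover have "AE x in mu_meas \<alpha>. f x = g (complex_of_real x)"
    using fourier_bessel_inversion[OF \<alpha> f] iF[OF \<alpha>] D[of 0] by (simp add: F_def)
  moreover have "Lp_norm 2 (\<alpha> + real k) (\<lambda>x. (D_op ^^ k) g (complex_of_real x))
      \<le> ennreal (sqrt (Gamma (\<alpha> + 1) / Gamma (\<alpha> + real k + 1)) * (sqrt (pi ^ 3) * b) ^ k) * Lp_norm 2 \<alpha> f" for k
  proof (rule Lp_norm_two_le)
    have \<beta>: "\<alpha> + real k > -1/2" using \<alpha> by linarith
    define K where "K = sqrt (Gamma (\<alpha> + 1) / Gamma (\<alpha> + real k + 1)) * (sqrt (pi ^ 3) * b) ^ k"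
    define r where "r = Gamma (\<alpha> + 1) / Gamma (\<alpha> + real k + 1)"
    have r: "r > 0" unfolding r_def using \<alpha> by (intro divide_pos_pos Gamma_real_pos) auto
    show "K > 0" unfolding K_def r_def[symmetric] using r assms(2) by simp
    \<comment> \<open>Of each three factors \<pi>, two come from the square of (-\<pi>)^k and one from the change of measure.\<close>
    have "K\<^sup>2 = r * (pi ^ 3 * b\<^sup>2) ^ k"
      using r by (simp add: K_def r_def[symmetric] power_mult_distrib power_mult[symmetric] mult.commute[of k 2])
         (simp add: power_mult)
    also have "\<dots> = (pi\<^sup>2) ^ k * (r * (pi * b\<^sup>2) ^ k)"
      by (simp add: power_mult_distrib[symmetric] mult_ac eval_nat_numeral)
    finally have K2: "K\<^sup>2 = (pi\<^sup>2) ^ k * (r * (pi * b\<^sup>2) ^ k)" .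
    have mF: "(\<lambda>x. ennreal ((norm (fourier_bessel (\<alpha> + real k) F x))\<^sup>2)) \<in> borel_measurable (mu_meas (\<alpha> + real k))"
    proof -
      have "fourier_bessel (\<alpha> + real k) F \<in> borel_measurable borel"
        by (intro borel_measurable_continuous_onI continuous_on_fourier_bessel[OF \<beta> iF[OF \<beta>]])
      then show ?thesis by (intro measurable_mu_meas_borel) measurable
    qed
    have "(\<integral>\<^sup>+x. ennreal ((norm ((D_op ^^ k) g (complex_of_real x)))\<^sup>2) \<partial>mu_meas (\<alpha> + real k))
        = (\<integral>\<^sup>+x. ennreal ((pi\<^sup>2) ^ k) * ennreal ((norm (fourier_bessel (\<alpha> + real k) F x))\<^sup>2) \<partial>mu_meas (\<alpha> + real k))"
      unfolding D by (simp add: norm_mult norm_power power_mult_distrib ennreal_mult power_mult[symmetric] mult.commute)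
    also have "\<dots> = ennreal ((pi\<^sup>2) ^ k) *
        (\<integral>\<^sup>+x. ennreal ((norm (fourier_bessel (\<alpha> + real k) F x))\<^sup>2) \<partial>mu_meas (\<alpha> + real k))"
      by (rule nn_integral_cmult[OF mF])
    also have "\<dots> \<le> ennreal ((pi\<^sup>2) ^ k) * (\<integral>\<^sup>+x. ennreal ((norm (F x))\<^sup>2) \<partial>mu_meas (\<alpha> + real k))"
      by (intro mult_left_mono fourier_bessel_nn_integral_sq_le[OF \<beta> iF[OF \<beta>]]) simp
    also have "\<dots> \<le> ennreal ((pi\<^sup>2) ^ k) * (ennreal (r * (pi * b\<^sup>2) ^ k) * (\<integral>\<^sup>+x. ennreal ((norm (F x))\<^sup>2) \<partial>mu_meas \<alpha>))"
      unfolding r_def by (intro mult_left_mono nn_integral_sq_shift_power_le[OF \<alpha> F]) simp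
    also have "\<dots> \<le> ennreal ((pi\<^sup>2) ^ k) * (ennreal (r * (pi * b\<^sup>2) ^ k) * (\<integral>\<^sup>+x. ennreal ((norm (f x))\<^sup>2) \<partial>mu_meas \<alpha>))"
      unfolding F_def by (intro mult_left_mono fourier_bessel_nn_integral_sq_le[OF \<alpha> f]) simp_all
    also have "\<dots> = ennreal (K\<^sup>2) * (\<integral>\<^sup>+x. ennreal ((norm (f x))\<^sup>2) \<partial>mu_meas \<alpha>)"
      unfolding K2 using r by (subst ennreal_mult) (auto simp: mult.assoc)
    finally show "(\<integral>\<^sup>+x. ennreal ((norm ((D_op ^^ k) g (complex_of_real x)))\<^sup>2) \<partial>mu_meas (\<alpha> + real k))
        \<le> ennreal (K\<^sup>2) * (\<integral>\<^sup>+x. ennreal ((norm (f x))\<^sup>2) \<partial>mu_meas \<alpha>)" .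
  qed
  ultimately show ?thesis by blast
qed

end
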